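(* Let $V=\frac{\partial}{\partial x^3}$ and $\eta=dx^3$, and let $\lambda,\mu$ be smooth functions on $I$ with $\mu$ not identically zero. Suppose $f_1=f_1(x^2)$ depends only on $x^2$ and $f_2=f_2(x^3)$ depends only on $x^3$, and put $d=\frac{f_2'}{f_2}$. Then $(I,\tilde g,V,\lambda,\mu)$ is an almost $\eta$-Ricci soliton if and only if $$d'=d(d+1),\qquad f_1'f_2'=0,\qquad \lambda=-f_2^2\left[\left(\frac{f_1'}{f_1}\right)'-\left(\frac{f_1'}{f_1}\right)^2\right]$$ and $$\mu=f_2^2\left[\left(\frac{f_1'}{f_1}\right)'-\left(\frac{f_1'}{f_1}\right)^2\right]-\left[\left(\frac{f_2'}{f_2}\right)'-\left(\frac{f_2'}{f_2}\right)^2\right].$$ Moreover, in this situation one of the following cases is satisfied: (i) $f_2=k_2\in\mathbb R\setminus\{0\}$ is constant and $\lambda=-f_2^2\left[\left(\frac{f_1'}{f_1}\right)'-\left(\frac{f_1'}{f_1}\right)^2\right]$, $\mu=f_2^2\left[\left(\frac{f_1'}{f_1}\right)'-\left(\frac{f_1'}{f_1}\right)^2\right]$; (ii) $f_1=k_1\in\mathbb R\setminus\{0\}$ is constant, $f_2(x^3)=\frac{c_1}{c_2e^{x^3}+1}$, where $c_1,c_2\in\mathbb R\setminus\{0\}$ are such that $c_2\neq-e^{-x^3}$ for all $x^3\in I_3$, and $\lambda=0$, $\mu=\frac{c_2e^{x^3}}{c_2e^{x^3}+1}$; (iii) $f_1=k_1\in\mathbb R\setminus\{0\}$ is constant, $f_2(x^3)=c_0e^{-x^3}$,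 where $c_0\in\mathbb R\setminus\{0\}$, and $\lambda=0$, $\mu=1$.
   Context: Let $I=I_1\times I_2\times I_3\subseteq\mathbb R^3$ with $I_1,I_2,I_3\subseteq\mathbb R$ open intervals and standard coordinates $x^1,x^2,x^3$. Let $f_1,f_2$ be smooth nowhere zero functions on $I$ and endow $I$ with the Riemannian metric $\tilde g=\frac{1}{f_1^2}dx^1\otimes dx^1+\frac{1}{f_2^2}dx^2\otimes dx^2+dx^3\otimes dx^3$, with orthonormal frame $E_1=f_1\frac{\partial}{\partial x^1}$, $E_2=f_2\frac{\partial}{\partial x^2}$, $E_3=\frac{\partial}{\partial x^3}$. For a smooth vector field $V$, a $1$-form $\eta$, and smooth functions $\lambda,\mu$ on $I$ with $\mu\neq0$ (not identically zero), $(I,\tilde g,V,\lambda,\mu)$ is an almost $\eta$-Ricci soliton if $\frac12\pounds_V\tilde g+\mathrm{Ric}+\lambda\tilde g+\mu\,\eta\otimes\eta=0$ on $I$, where $\pounds_V\tilde g$ is the Lie derivative of $\tilde g$ along $V$ and $\mathrm{Ric}$ is the Ricci tensor of $\tilde g$, with $\mathrm{Ric}(Y,Z)=\sum_{k}\tilde g(R(E_k,Y)Z,E_k)$, $R(X,Y)Z=\nabla_X\nabla_YZ-\nabla_Y\nabla_XZ-\nabla_{[X,Y]}Z$, $\nabla$ the Levi-Civita connection. A prime denotes the derivative of a function of a single variable with respect to that variable. *)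

theory Defs
  imports "HOL-Analysis.Analysis"
begin

text \<open>
  Geometry is done on an open subset \<open>U\<close> of \<open>real ^ 'n\<close>, each tangent space being identified with
  \<open>real ^ 'n\<close> through the coordinate frame. All fields are total functions; only their values on
  \<open>U\<close> matter.
\<close>

type_synonym 'n vfield = "real ^ 'n \<Rightarrow> real ^ 'n"
type_synonym 'n one_form = "real ^ 'n \<Rightarrow> real ^ 'n \<Rightarrow> real"
type_synonym 'n metric = "real ^ 'n \<Rightarrow> real ^ 'n \<Rightarrow> real ^ 'n \<Rightarrow> real"

subsection \<open>Smoothness\<close>

primrec Ck_on :: "nat \<Rightarrow> 'a::euclidean_space set \<Rightarrow> ('a \<Rightarrow> 'b::euclidean_space) \<Rightarrow> bool" where
  "Ck_on 0 U f \<longleftrightarrow> continuous_on U f"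
| "Ck_on (Suc k) U f \<longleftrightarrow>
     (\<forall>x\<in>U. f differentiable (at x)) \<and>
     (\<forall>v. Ck_on k U (\<lambda>x. frechet_derivative f (at x) v))"

definition smooth_on :: "'a::euclidean_space set \<Rightarrow> ('a \<Rightarrow> 'b::euclidean_space) \<Rightarrow> bool" where
  "smooth_on U f \<longleftrightarrow> (\<forall>k. Ck_on k U f)"

definition smooth_one_form_on :: "(real ^ 'n) set \<Rightarrow> 'n::finite one_form \<Rightarrow> bool" where
  "smooth_one_form_on U \<eta> \<longleftrightarrow>
     (\<forall>x\<in>U. linear (\<eta> x)) \<and> (\<forall>v. smooth_on U (\<lambda>x. \<eta> x v))"

subsection \<open>Metrics, frames and the Levi-Civita connection\<close>

definition riemannian_metric_on :: "(real ^ 'n) set \<Rightarrow> 'n::finite metric \<Rightarrow> bool" where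
  "riemannian_metric_on U g \<longleftrightarrow>
     (\<forall>x\<in>U. bilinear (g x) \<and> (\<forall>u v. g x u v = g x v u) \<and> (\<forall>v. v \<noteq> 0 \<longrightarrow> g x v v > 0)) \<and>
     (\<forall>u v. smooth_on U (\<lambda>x. g x u v))"

definition orthonormal_frame_on ::
    "(real ^ 'n) set \<Rightarrow> 'n::finite metric \<Rightarrow> ('n \<Rightarrow> 'n vfield) \<Rightarrow> bool" where
  "orthonormal_frame_on U g E \<longleftrightarrow>
     (\<forall>i. smooth_on U (E i)) \<and>
     (\<forall>x\<in>U. \<forall>i j. g x (E i x) (E j x) = (if i = j then 1 else 0))"

definition dir_deriv :: "'n::finite vfield \<Rightarrow> (real ^ 'n \<Rightarrow> real) \<Rightarrow> real ^ 'n \<Rightarrow> real" where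
  "dir_deriv X f x = frechet_derivative f (at x) (X x)"

definition lie_bracket :: "'n::finite vfield \<Rightarrow> 'n vfield \<Rightarrow> 'n vfield" where
  "lie_bracket X Y x = frechet_derivative Y (at x) (X x) - frechet_derivative X (at x) (Y x)"

definition affine_connection_on ::
    "(real ^ 'n) set \<Rightarrow> ('n::finite vfield \<Rightarrow> 'n vfield \<Rightarrow> 'n vfield) \<Rightarrow> bool" where
  "affine_connection_on U nabla \<longleftrightarrow>
     (\<forall>X Y. smooth_on U X \<longrightarrow> smooth_on U Y \<longrightarrow> smooth_on U (nabla X Y)) \<and>
     (\<forall>X X' Y. smooth_on U X \<longrightarrow> smooth_on U X' \<longrightarrow> smooth_on U Y \<longrightarrow>
        (\<forall>x\<in>U. nabla (\<lambda>y. X y + X' y) Y x = nabla X Y x + nabla X' Y x)) \<and>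
     (\<forall>f X Y. smooth_on U f \<longrightarrow> smooth_on U X \<longrightarrow> smooth_on U Y \<longrightarrow>
        (\<forall>x\<in>U. nabla (\<lambda>y. f y *\<^sub>R X y) Y x = f x *\<^sub>R nabla X Y x)) \<and>
     (\<forall>X Y Y'. smooth_on U X \<longrightarrow> smooth_on U Y \<longrightarrow> smooth_on U Y' \<longrightarrow>
        (\<forall>x\<in>U. nabla X (\<lambda>y. Y y + Y' y) x = nabla X Y x + nabla X Y' x)) \<and>
     (\<forall>f X Y. smooth_on U f \<longrightarrow> smooth_on U X \<longrightarrow> smooth_on U Y \<longrightarrow>
        (\<forall>x\<in>U. nabla X (\<lambda>y. f y *\<^sub>R Y y) x = dir_deriv X f x *\<^sub>R Y x + f x *\<^sub>R nabla X Y x))"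

definition is_levi_civita ::
    "(real ^ 'n) set \<Rightarrow> 'n::finite metric \<Rightarrow> ('n vfield \<Rightarrow> 'n vfield \<Rightarrow> 'n vfield) \<Rightarrow> bool" where
  "is_levi_civita U g nabla \<longleftrightarrow>
     affine_connection_on U nabla \<and>
     (\<forall>X Y. smooth_on U X \<longrightarrow> smooth_on U Y \<longrightarrow>
        (\<forall>x\<in>U. nabla X Y x - nabla Y X x = lie_bracket X Y x)) \<and>
     (\<forall>X Y Z. smooth_on U X \<longrightarrow> smooth_on U Y \<longrightarrow> smooth_on U Z \<longrightarrow>
        (\<forall>x\<in>U. dir_deriv X (\<lambda>y. g y (Y y) (Z y)) x
                = g x (nabla X Y x) (Z x) + g x (Y x) (nabla X Z x)))"

text \<open>
  By the fundamental theorem of Riemannian geometry, for \<open>U\<close> open and \<open>g\<close> a Riemannian metric on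
  \<open>U\<close> such a connection exists, and its values \<open>nabla X Y x\<close> for \<open>X\<close>, \<open>Y\<close> smooth on \<open>U\<close> and
  \<open>x \<in> U\<close> are unique. The choice operator below therefore only decides irrelevant values
  (points outside \<open>U\<close>, fields that are not smooth).
\<close>

definition levi_civita ::
    "(real ^ 'n) set \<Rightarrow> 'n::finite metric \<Rightarrow> 'n vfield \<Rightarrow> 'n vfield \<Rightarrow> 'n vfield" where
  "levi_civita U g = (SOME nabla. is_levi_civita U g nabla)"

definition curvature ::
    "('n::finite vfield \<Rightarrow> 'n vfield \<Rightarrow> 'n vfield) \<Rightarrow> 'n vfield \<Rightarrow> 'n vfield \<Rightarrow> 'n vfield \<Rightarrow> 'n vfield" where
  "curvature nabla X Y Z x =
     nabla X (nabla Y Z) x - nabla Y (nabla X Z) x - nabla (lie_bracket X Y) Z x"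

definition ricci ::
    "(real ^ 'n) set \<Rightarrow> 'n::finite metric \<Rightarrow> ('n \<Rightarrow> 'n vfield) \<Rightarrow>
     'n vfield \<Rightarrow> 'n vfield \<Rightarrow> real ^ 'n \<Rightarrow> real" where
  "ricci U g E Y Z x = (\<Sum>k\<in>UNIV. g x (curvature (levi_civita U g) (E k) Y Z x) (E k x))"

definition lie_derivative_metric ::
    "'n::finite vfield \<Rightarrow> 'n metric \<Rightarrow> 'n vfield \<Rightarrow> 'n vfield \<Rightarrow> real ^ 'n \<Rightarrow> real" where
  "lie_derivative_metric V g Y Z x =
     dir_deriv V (\<lambda>y. g y (Y y) (Z y)) x
     - g x (lie_bracket V Y x) (Z x) - g x (Y x) (lie_bracket V Z x)"

text \<open>
  The frame \<open>E\<close> enters only through the trace defining the Ricci tensor, which does not depend on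
  the choice of the orthonormal frame.
\<close>

definition almost_eta_ricci_soliton ::
    "(real ^ 'n) set \<Rightarrow> 'n::finite metric \<Rightarrow> ('n \<Rightarrow> 'n vfield) \<Rightarrow> 'n vfield \<Rightarrow> 'n one_form \<Rightarrow>
     (real ^ 'n \<Rightarrow> real) \<Rightarrow> (real ^ 'n \<Rightarrow> real) \<Rightarrow> bool" where
  "almost_eta_ricci_soliton U g E V \<eta> lam mu \<longleftrightarrow>
     riemannian_metric_on U g \<and> orthonormal_frame_on U g E \<and>
     smooth_on U V \<and> smooth_one_form_on U \<eta> \<and> smooth_on U lam \<and> smooth_on U mu \<and>
     (\<exists>x\<in>U. mu x \<noteq> 0) \<and>
     (\<forall>Y Z. smooth_on U Y \<longrightarrow> smooth_on U Z \<longrightarrow>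
       (\<forall>x\<in>U. (1/2) * lie_derivative_metric V g Y Z x + ricci U g E Y Z x
               + lam x * g x (Y x) (Z x) + mu x * (\<eta> x (Y x) * \<eta> x (Z x)) = 0))"

subsection \<open>The three-dimensional setting\<close>

definition open_interval :: "real set \<Rightarrow> bool" where
  "open_interval J \<longleftrightarrow> open J \<and> is_interval J \<and> J \<noteq> {}"

definition box3 :: "real set \<Rightarrow> real set \<Rightarrow> real set \<Rightarrow> (real ^ 3) set" where
  "box3 I1 I2 I3 = {x. x $ 1 \<in> I1 \<and> x $ 2 \<in> I2 \<and> x $ 3 \<in> I3}"

definition g_tilde :: "(real ^ 3 \<Rightarrow> real) \<Rightarrow> (real ^ 3 \<Rightarrow> real) \<Rightarrow> 3 metric" where
  "g_tilde f1 f2 x u v =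
     1 / (f1 x)\<^sup>2 * (u $ 1 * v $ 1) + 1 / (f2 x)\<^sup>2 * (u $ 2 * v $ 2) + u $ 3 * v $ 3"

definition E_frame :: "(real ^ 3 \<Rightarrow> real) \<Rightarrow> (real ^ 3 \<Rightarrow> real) \<Rightarrow> 3 \<Rightarrow> 3 vfield" where
  "E_frame f1 f2 i x =
     (if i = 1 then f1 x *\<^sub>R axis 1 1 else if i = 2 then f2 x *\<^sub>R axis 2 1 else axis 3 1)"

definition d_dx3 :: "3 vfield" where
  "d_dx3 x = axis 3 1"

definition dx3 :: "3 one_form" where
  "dx3 x v = v $ 3"

end

theory Submission
  imports Defs
begin

text \<open>
  The Christoffel symbols of \<open>g_tilde\<close> give an explicit connection, and a torsion-free metric
  connection is unique, so \<open>levi_civita\<close> agrees with it on smooth fields. Its Ricci tensor has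
  frame components \<open>Ric\<^sub>1\<^sub>1 = f\<^sub>2\<^sup>2 F\<close>, \<open>Ric\<^sub>2\<^sub>2 = f\<^sub>2\<^sup>2 F + d' - d\<^sup>2\<close>, \<open>Ric\<^sub>3\<^sub>3 = d' - d\<^sup>2\<close>,
  \<open>Ric\<^sub>2\<^sub>3 = f\<^sub>2 h d\<close> and zero otherwise, while half the Lie derivative of the metric contributes \<open>- d\<close>
  in the slot \<open>22\<close>; comparing components yields the four equations. The condition \<open>f\<^sub>1' f\<^sub>2' = 0\<close> makes
  \<open>f\<^sub>1\<close> or \<open>f\<^sub>2\<close> constant, and if \<open>f\<^sub>2\<close> is not constant then \<open>1 / f\<^sub>2\<close> solves \<open>u'' = u'\<close>, hence
  equals \<open>A + B e\<^sup>t\<close> with \<open>B \<noteq> 0\<close>; the cases (ii) and (iii) are \<open>A \<noteq> 0\<close> and \<open>A = 0\<close>.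
\<close>

subsection \<open>Calculus of smooth functions\<close>

lemma Ck_on_Suc_has_derivative:
  "Ck_on (Suc k) U f \<Longrightarrow> x \<in> U \<Longrightarrow> (f has_derivative frechet_derivative f (at x)) (at x)"
  using frechet_derivative_works by auto

text \<open>A Frechet derivative depends only on values near the point, so on an open set the values
  outside are irrelevant. The closure lemmas below use this to replace the derivative of a compound
  function by its formula, which is known only on \<open>U\<close>.\<close>

lemma Ck_on_cong:
  assumes "open U" "\<And>x. x \<in> U \<Longrightarrow> f x = g x" "Ck_on k U f"
  shows "Ck_on k U g"
  using assms(2,3)
proof (induction k arbitrary: f g)
  case 0
  then show ?case by (simp cong: continuous_on_cong)
next
  case (Suc k)
  note D = Ck_on_Suc_has_derivative[OF Suc.prems(2)]
  have Dg: "(g has_derivative frechet_derivative f (at x)) (at x)" if "x \<in> U" for x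
    using has_derivative_transform_within_open[OF D[OF that] \<open>open U\<close> that] Suc.prems(1) by blast
  have eq: "frechet_derivative f (at x) v = frechet_derivative g (at x) v" if "x \<in> U" for x v
    using frechet_derivative_at[OF Dg[OF that]] by simp
  show ?case
    using Suc.prems(2) Suc.IH[OF eq] Dg by (auto simp: differentiable_def)
qed

lemma Ck_on_SucD: "Ck_on (Suc k) U f \<Longrightarrow> Ck_on k U f"
proof (induction k arbitrary: f)
  case 0
  then show ?case
    by (auto intro!: continuous_at_imp_continuous_on differentiable_imp_continuous_within)
next
  case (Suc k)
  then show ?case by simp
qed

lemma Ck_on_const: "Ck_on k U (\<lambda>x. c)"
  by (induction k arbitrary: c) auto

lemma Ck_on_bounded_linear:
  assumes "open U" "bounded_linear L" "Ck_on k U f"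
  shows "Ck_on k U (\<lambda>x. L (f x))"
  using assms(3)
proof (induction k arbitrary: f)
  case 0
  then show ?case by (simp add: assms(2) bounded_linear.continuous_on)
next
  case (Suc k)
  have D: "((\<lambda>x. L (f x)) has_derivative (\<lambda>v. L (frechet_derivative f (at x) v))) (at x)"
    if "x \<in> U" for x
    by (rule bounded_linear.has_derivative[OF assms(2) Ck_on_Suc_has_derivative[OF Suc.prems that]])
  have eq: "L (frechet_derivative f (at x) v) = frechet_derivative (\<lambda>x. L (f x)) (at x) v"
    if "x \<in> U" for x v
    using frechet_derivative_at[OF D[OF that]] by metis
  have "Ck_on k U (\<lambda>x. frechet_derivative (\<lambda>x. L (f x)) (at x) v)" for v
    by (rule Ck_on_cong[OF \<open>open U\<close> eq Suc.IH]) (use Suc.prems in auto)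
  then show ?case using D by (auto simp: differentiable_def)
qed

lemma Ck_on_add:
  assumes "open U" "Ck_on k U f" "Ck_on k U g"
  shows "Ck_on k U (\<lambda>x. f x + g x)"
  using assms(2,3)
proof (induction k arbitrary: f g)
  case 0
  then show ?case by (simp add: continuous_on_add)
next
  case (Suc k)
  have D: "((\<lambda>x. f x + g x) has_derivative
      (\<lambda>v. frechet_derivative f (at x) v + frechet_derivative g (at x) v)) (at x)"
    if "x \<in> U" for x
    by (rule has_derivative_add[OF Ck_on_Suc_has_derivative[OF Suc.prems(1) that]
          Ck_on_Suc_has_derivative[OF Suc.prems(2) that]])
  have eq: "frechet_derivative f (at x) v + frechet_derivative g (at x) v
      = frechet_derivative (\<lambda>x. f x + g x) (at x) v"
    if "x \<in> U" for x v
    using frechet_derivative_at[OF D[OF that]] by metis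
  have "Ck_on k U (\<lambda>x. frechet_derivative (\<lambda>x. f x + g x) (at x) v)" for v
    by (rule Ck_on_cong[OF \<open>open U\<close> eq Suc.IH]) (use Suc.prems in auto)
  then show ?case using D by (auto simp: differentiable_def)
qed

text \<open>The product rule writes the derivative as a sum of two products of the same shape with
  one factor differentiated, so the induction runs over both factors at once. Multiplication and
  scaling of vectors are both instances.\<close>

lemma Ck_on_bounded_bilinear:
  assumes "open U" "bounded_bilinear pr" "Ck_on k U f" "Ck_on k U g"
  shows "Ck_on k U (\<lambda>x. pr (f x) (g x))"
  using assms(3,4)
proof (induction k arbitrary: f g)
  case 0
  then show ?case by (simp add: assms(2) bounded_bilinear.continuous_on)
next
  case (Suc k)
  have D: "((\<lambda>x. pr (f x) (g x)) has_derivative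
      (\<lambda>v. pr (f x) (frechet_derivative g (at x) v) + pr (frechet_derivative f (at x) v) (g x))) (at x)"
    if "x \<in> U" for x
    by (rule bounded_bilinear.FDERIV[OF assms(2)
          Ck_on_Suc_has_derivative[OF Suc.prems(1) that]
          Ck_on_Suc_has_derivative[OF Suc.prems(2) that]])
  have eq: "pr (f x) (frechet_derivative g (at x) v) + pr (frechet_derivative f (at x) v) (g x)
      = frechet_derivative (\<lambda>x. pr (f x) (g x)) (at x) v"
    if "x \<in> U" for x v
    using frechet_derivative_at[OF D[OF that]] by metis
  have "Ck_on k U (\<lambda>x. frechet_derivative (\<lambda>x. pr (f x) (g x)) (at x) v)" for v
    by (rule Ck_on_cong[OF \<open>open U\<close> eq Ck_on_add[OF \<open>open U\<close> Suc.IH Suc.IH]])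
      (use Suc.prems Ck_on_SucD in auto)
  then show ?case using D by (auto simp: differentiable_def)
qed

text \<open>The derivative of the inverse is built from the inverse itself and the derivative of
  \<open>f\<close>. The induction hypothesis for the same \<open>f\<close> therefore supplies
  exactly the regularity needed.\<close>

lemma Ck_on_inverse:
  fixes f :: "'a::euclidean_space \<Rightarrow> real"
  assumes "open U" "\<And>x. x \<in> U \<Longrightarrow> f x \<noteq> 0" "Ck_on k U f"
  shows "Ck_on k U (\<lambda>x. inverse (f x))"
  using assms(3)
proof (induction k)
  case 0
  then show ?case using assms(2) by (auto intro!: continuous_on_inverse)
next
  case (Suc k)
  have D: "((\<lambda>x. inverse (f x)) has_derivative
      (\<lambda>v. - (inverse (f x) * frechet_derivative f (at x) v * inverse (f x)))) (at x)"
    if "x \<in> U" for x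
    by (rule Deriv.has_derivative_inverse[OF assms(2)[OF that]
          Ck_on_Suc_has_derivative[OF Suc.prems that]])
  have eq: "- (inverse (f x) * frechet_derivative f (at x) v * inverse (f x))
      = frechet_derivative (\<lambda>x. inverse (f x)) (at x) v"
    if "x \<in> U" for x v
    using frechet_derivative_at[OF D[OF that]] by metis
  have inv: "Ck_on k U (\<lambda>x. inverse (f x))"
    using Suc.IH Suc.prems Ck_on_SucD by blast
  have "Ck_on k U (\<lambda>x. frechet_derivative (\<lambda>x. inverse (f x)) (at x) v)" for v
    by (rule Ck_on_cong[OF \<open>open U\<close> eq Ck_on_bounded_linear[OF \<open>open U\<close> bounded_linear_minus[OF bounded_linear_ident]]],
        assumption, intro Ck_on_bounded_bilinear[OF \<open>open U\<close> bounded_bilinear_mult] inv)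
      (use Suc.prems in auto)
  then show ?case using D by (auto simp: differentiable_def)
qed

section \<open>Smooth functions and differentiation along smooth fields\<close>

lemma smooth_on_cong:
  assumes "open U" "\<And>x. x \<in> U \<Longrightarrow> f x = g x" "smooth_on U f"
  shows "smooth_on U g"
  unfolding smooth_on_def
proof
  fix k
  have "Ck_on k U f" using assms(3) by (simp add: smooth_on_def)
  with Ck_on_cong[OF assms(1), of f g] assms(2) show "Ck_on k U g" by blast
qed

lemma smooth_on_const [simp, intro]: "smooth_on U (\<lambda>x. c)"
  by (simp add: smooth_on_def Ck_on_const)

lemma smooth_on_bounded_linear:
  "open U \<Longrightarrow> bounded_linear L \<Longrightarrow> smooth_on U f \<Longrightarrow> smooth_on U (\<lambda>x. L (f x))"
  by (simp add: smooth_on_def Ck_on_bounded_linear)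

lemma smooth_on_bounded_bilinear:
  "open U \<Longrightarrow> bounded_bilinear pr \<Longrightarrow> smooth_on U f \<Longrightarrow> smooth_on U g \<Longrightarrow>
    smooth_on U (\<lambda>x. pr (f x) (g x))"
  by (simp add: smooth_on_def Ck_on_bounded_bilinear)

lemma smooth_on_add: "open U \<Longrightarrow> smooth_on U f \<Longrightarrow> smooth_on U g \<Longrightarrow> smooth_on U (\<lambda>x. f x + g x)"
  by (simp add: smooth_on_def Ck_on_add)

lemma smooth_on_minus: "open U \<Longrightarrow> smooth_on U f \<Longrightarrow> smooth_on U (\<lambda>x. - f x)"
  using smooth_on_bounded_linear[OF _ bounded_linear_minus[OF bounded_linear_ident]] .

lemma smooth_on_diff: "open U \<Longrightarrow> smooth_on U f \<Longrightarrow> smooth_on U g \<Longrightarrow> smooth_on U (\<lambda>x. f x - g x)"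
  using smooth_on_add[of U f "\<lambda>x. - g x"] smooth_on_minus[of U g] by simp

lemma smooth_on_scaleR:
  "open U \<Longrightarrow> smooth_on U f \<Longrightarrow> smooth_on U g \<Longrightarrow> smooth_on U (\<lambda>x. f x *\<^sub>R g x)"
  by (rule smooth_on_bounded_bilinear[OF _ bounded_bilinear_scaleR])

lemma smooth_on_mult:
  fixes f g :: "'a::euclidean_space \<Rightarrow> real"
  shows "open U \<Longrightarrow> smooth_on U f \<Longrightarrow> smooth_on U g \<Longrightarrow> smooth_on U (\<lambda>x. f x * g x)"
  by (rule smooth_on_bounded_bilinear[OF _ bounded_bilinear_mult])

lemma smooth_on_divide:
  fixes f g :: "'a::euclidean_space \<Rightarrow> real"
  assumes "open U" "smooth_on U f" "smooth_on U g" "\<And>x. x \<in> U \<Longrightarrow> g x \<noteq> 0"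
  shows "smooth_on U (\<lambda>x. f x / g x)"
proof -
  have "smooth_on U (\<lambda>x. inverse (g x))"
    using Ck_on_inverse[OF assms(1,4)] assms(3) by (simp add: smooth_on_def)
  from smooth_on_mult[OF assms(1,2) this] show ?thesis by (simp add: divide_inverse)
qed

lemma smooth_on_power:
  fixes f :: "'a::euclidean_space \<Rightarrow> real"
  assumes "open U" "smooth_on U f"
  shows "smooth_on U (\<lambda>x. f x ^ n)"
  by (induction n) (simp_all add: smooth_on_mult[OF assms])

lemma smooth_on_sum:
  assumes "open U" "\<And>i. i \<in> S \<Longrightarrow> smooth_on U (f i)"
  shows "smooth_on U (\<lambda>x. \<Sum>i\<in>S. f i x)"
  using assms(2) by (induction S rule: infinite_finite_induct) (simp_all add: smooth_on_add[OF assms(1)])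

lemma smooth_on_nth: "open U \<Longrightarrow> smooth_on U f \<Longrightarrow> smooth_on U (\<lambda>x. f x $ i)"
  by (rule smooth_on_bounded_linear[OF _ bounded_linear_vec_nth])

lemma smooth_onD_Suc: "smooth_on U f \<Longrightarrow> Ck_on (Suc k) U f"
  by (simp only: smooth_on_def)

lemma smooth_onD_differentiable: "smooth_on U f \<Longrightarrow> x \<in> U \<Longrightarrow> f differentiable (at x)"
  using smooth_onD_Suc[of U f 0] by simp

lemma smooth_onD_has_derivative:
  "smooth_on U f \<Longrightarrow> x \<in> U \<Longrightarrow> (f has_derivative frechet_derivative f (at x)) (at x)"
  by (simp add: smooth_onD_differentiable flip: frechet_derivative_works)

lemma smooth_onD_continuous: "smooth_on U f \<Longrightarrow> continuous_on U f"
  using Ck_on.simps(1) unfolding smooth_on_def by blast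

lemma smooth_on_frechet_derivative:
  "smooth_on U f \<Longrightarrow> smooth_on U (\<lambda>x. frechet_derivative f (at x) v)"
  unfolding smooth_on_def[of U "\<lambda>x. frechet_derivative f (at x) v"]
  using smooth_onD_Suc[of U f] by simp

text \<open>\<open>Ck_on\<close> speaks of derivatives in fixed directions only. This expansion
  reduces derivatives in a moving direction to those in finitely many fixed ones.\<close>

lemma frechet_derivative_basis_expansion:
  assumes "smooth_on U f" "x \<in> U"
  shows "(\<Sum>b\<in>Basis. (u \<bullet> b) *\<^sub>R frechet_derivative f (at x) b) = frechet_derivative f (at x) u"
proof -
  have "linear (frechet_derivative f (at x))"
    by (rule linear_frechet_derivative[OF smooth_onD_differentiable[OF assms]])
  then have "frechet_derivative f (at x) (\<Sum>b\<in>Basis. (u \<bullet> b) *\<^sub>R b)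
    = (\<Sum>b\<in>Basis. (u \<bullet> b) *\<^sub>R frechet_derivative f (at x) b)"
    by (simp add: linear_sum linear_scale o_def)
  then show ?thesis by (simp add: euclidean_representation)
qed

lemma smooth_on_frechet_derivative_along:
  assumes "open U" "smooth_on U f" "smooth_on U X"
  shows "smooth_on U (\<lambda>x. frechet_derivative f (at x) (X x))"
proof (rule smooth_on_cong[OF \<open>open U\<close>])
  show "smooth_on U (\<lambda>x. \<Sum>b\<in>Basis. (X x \<bullet> b) *\<^sub>R frechet_derivative f (at x) b)"
    by (intro smooth_on_sum smooth_on_scaleR smooth_on_frechet_derivative
        smooth_on_bounded_linear[OF _ bounded_linear_inner_left] assms)
qed (rule frechet_derivative_basis_expansion[OF assms(2)])

lemmas smooth_on_intros =
  smooth_on_const smooth_on_add smooth_on_minus smooth_on_diff smooth_on_scaleR smooth_on_mult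
  smooth_on_divide smooth_on_power smooth_on_sum smooth_on_nth smooth_on_frechet_derivative_along

lemma smooth_on_lie_bracket:
  "open U \<Longrightarrow> smooth_on U X \<Longrightarrow> smooth_on U Y \<Longrightarrow> smooth_on U (lie_bracket X Y)"
  unfolding lie_bracket_def by (intro smooth_on_diff smooth_on_frechet_derivative_along)

lemma frechet_derivative_eqI:
  "(f has_derivative f') (at x) \<Longrightarrow> frechet_derivative f (at x) v = f' v"
  using frechet_derivative_at by metis

text \<open>The product rule for a derivative taken along a moving direction: one term
  differentiates the derivative of \<open>Z\<close> with the direction frozen at \<open>Y x\<close>,
  the other differentiates the direction. Both are obtained through the basis expansion.\<close>

lemma has_derivative_frechet_derivative_along:
  fixes Z :: "'a::euclidean_space \<Rightarrow> 'b::euclidean_space"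
  assumes "open U" "x \<in> U" and Y: "smooth_on U Y" and Z: "smooth_on U Z"
  shows "((\<lambda>y. frechet_derivative Z (at y) (Y y)) has_derivative
    (\<lambda>w. frechet_derivative (\<lambda>y. frechet_derivative Z (at y) (Y x)) (at x) w
       + frechet_derivative Z (at x) (frechet_derivative Y (at x) w))) (at x)"
proof -
  let ?S = "\<lambda>u. frechet_derivative (\<lambda>y. frechet_derivative Z (at y) u) (at x)"
  note expand = frechet_derivative_basis_expansion[OF Z]
  have DZ: "((\<lambda>y. frechet_derivative Z (at y) b) has_derivative ?S b) (at x)" for b
    by (rule smooth_onD_has_derivative[OF smooth_on_frechet_derivative[OF Z] \<open>x \<in> U\<close>])
  have DY: "((\<lambda>y. Y y \<bullet> b) has_derivative (\<lambda>w. frechet_derivative Y (at x) w \<bullet> b)) (at x)" for b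
    by (rule has_derivative_inner_left[OF smooth_onD_has_derivative[OF Y \<open>x \<in> U\<close>]])
  \<comment> \<open>The second derivative is linear in the inner direction \<open>u\<close>, because
    the basis expansion of the first derivative holds throughout the neighbourhood \<open>U\<close>
    of \<open>x\<close>.\<close>
  have S: "?S u w = (\<Sum>b\<in>Basis. (u \<bullet> b) *\<^sub>R ?S b w)" for u w
  proof (rule frechet_derivative_eqI, rule has_derivative_transform_within_open[OF _ \<open>open U\<close> \<open>x \<in> U\<close>])
    show "((\<lambda>y. \<Sum>b\<in>Basis. (u \<bullet> b) *\<^sub>R frechet_derivative Z (at y) b) has_derivative
        (\<lambda>w. \<Sum>b\<in>Basis. (u \<bullet> b) *\<^sub>R ?S b w)) (at x)"
      by (intro has_derivative_sum has_derivative_scaleR_right DZ)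
  qed (rule expand)
  have "((\<lambda>y. \<Sum>b\<in>Basis. (Y y \<bullet> b) *\<^sub>R frechet_derivative Z (at y) b) has_derivative
      (\<lambda>w. \<Sum>b\<in>Basis. (Y x \<bullet> b) *\<^sub>R ?S b w
        + (frechet_derivative Y (at x) w \<bullet> b) *\<^sub>R frechet_derivative Z (at x) b)) (at x)"
    by (intro has_derivative_sum has_derivative_scaleR DZ DY)
  then have "((\<lambda>y. \<Sum>b\<in>Basis. (Y y \<bullet> b) *\<^sub>R frechet_derivative Z (at y) b) has_derivative
      (\<lambda>w. ?S (Y x) w + frechet_derivative Z (at x) (frechet_derivative Y (at x) w))) (at x)"
    by (simp add: sum.distrib S[of "Y x"] expand[OF \<open>x \<in> U\<close>])
  then show ?thesis
    by (rule has_derivative_transform_within_open[OF _ \<open>open U\<close> \<open>x \<in> U\<close>]) (rule expand)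
qed

subsection \<open>Symmetry of second derivatives\<close>

text \<open>The mean value theorem, applied once in each direction, to a second difference quotient.\<close>

lemma second_difference_mvt:
  fixes f :: "'a::euclidean_space \<Rightarrow> real"
  assumes sm: "smooth_on U f" and "t > 0"
    and inU: "\<And>a b. 0 \<le> a \<Longrightarrow> a \<le> t \<Longrightarrow> 0 \<le> b \<Longrightarrow> b \<le> t \<Longrightarrow> x + a *\<^sub>R u + b *\<^sub>R v \<in> U"
  shows "\<exists>a b. 0 \<le> a \<and> a \<le> t \<and> 0 \<le> b \<and> b \<le> t \<and>
    f (x + t *\<^sub>R u + t *\<^sub>R v) - f (x + t *\<^sub>R u) - f (x + t *\<^sub>R v) + f x
     = t\<^sup>2 * frechet_derivative (\<lambda>y. frechet_derivative f (at y) u) (at (x + a *\<^sub>R u + b *\<^sub>R v)) v"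
proof -
  let ?Du = "\<lambda>y. frechet_derivative f (at y) u"
  have Df: "(f has_derivative frechet_derivative f (at y)) (at y)" if "y \<in> U" for y
    using smooth_onD_has_derivative[OF sm that] .
  have DDu: "(?Du has_derivative frechet_derivative ?Du (at y)) (at y)" if "y \<in> U" for y
    using smooth_onD_has_derivative[OF smooth_on_frechet_derivative[OF sm] that] .
  have lin: "frechet_derivative g (at y) (k *\<^sub>R w) = k * frechet_derivative g (at y) w"
    if "(g has_derivative frechet_derivative g (at y)) (at y)" for g :: "'a \<Rightarrow> real" and y k w
    using has_derivative_linear[OF that] by (simp add: linear_scale)
  have 1: "((\<lambda>a. f (x + a *\<^sub>R u + c *\<^sub>R v)) has_real_derivative ?Du (x + a *\<^sub>R u + c *\<^sub>R v)) (at a)"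
    if "0 \<le> a" "a \<le> t" "0 \<le> c" "c \<le> t" for a c
  proof -
    have "((\<lambda>a. f (x + a *\<^sub>R u + c *\<^sub>R v)) has_derivative
        (\<lambda>k. frechet_derivative f (at (x + a *\<^sub>R u + c *\<^sub>R v)) (k *\<^sub>R u))) (at a)"
      by (rule has_derivative_compose[where g = f and f = "\<lambda>a. x + a *\<^sub>R u + c *\<^sub>R v"])
        (auto intro!: derivative_eq_intros Df[OF inU[OF that]])
    then show ?thesis
      using lin[OF Df[OF inU[OF that]]] by (simp add: has_field_derivative_def mult_commute_abs)
  qed
  \<comment> \<open>The increment along \<open>v\<close> as a function of the displacement along
    \<open>u\<close>. The summand \<open>0 *\<^sub>R v\<close> is kept so that fact \<open>1\<close>
    applies to both terms.\<close>
  let ?\<phi> = "\<lambda>a. f (x + a *\<^sub>R u + t *\<^sub>R v) - f (x + a *\<^sub>R u + 0 *\<^sub>R v)"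
  have "\<exists>z>0. z < t \<and> ?\<phi> t - ?\<phi> 0 = (t - 0) * (?Du (x + z *\<^sub>R u + t *\<^sub>R v) - ?Du (x + z *\<^sub>R u + 0 *\<^sub>R v))"
    using \<open>t > 0\<close> by (intro MVT2 DERIV_diff 1) auto
  then obtain a where a: "0 < a" "a < t"
    "?\<phi> t - ?\<phi> 0 = t * (?Du (x + a *\<^sub>R u + t *\<^sub>R v) - ?Du (x + a *\<^sub>R u + 0 *\<^sub>R v))" by auto
  let ?\<psi> = "\<lambda>b. frechet_derivative ?Du (at (x + a *\<^sub>R u + b *\<^sub>R v)) v"
  have "((\<lambda>b. ?Du (x + a *\<^sub>R u + b *\<^sub>R v)) has_real_derivative ?\<psi> b) (at b)"
    if "0 \<le> b" "b \<le> t" for b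
  proof -
    have i: "x + a *\<^sub>R u + b *\<^sub>R v \<in> U" using a that by (intro inU) auto
    have "((\<lambda>b. ?Du (x + a *\<^sub>R u + b *\<^sub>R v)) has_derivative
        (\<lambda>k. frechet_derivative ?Du (at (x + a *\<^sub>R u + b *\<^sub>R v)) (k *\<^sub>R v))) (at b)"
      by (rule has_derivative_compose[where g = ?Du and f = "\<lambda>b. x + a *\<^sub>R u + b *\<^sub>R v"])
        (auto intro!: derivative_eq_intros DDu[OF i])
    then show ?thesis
      using lin[OF DDu[OF i]] by (simp add: has_field_derivative_def mult_commute_abs)
  qed
  then have "\<exists>z>0. z < t \<and> ?Du (x + a *\<^sub>R u + t *\<^sub>R v) - ?Du (x + a *\<^sub>R u + 0 *\<^sub>R v) = (t - 0) * ?\<psi> z"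
    using \<open>t > 0\<close> by (intro MVT2) auto
  then obtain b where b: "0 < b" "b < t"
    "?Du (x + a *\<^sub>R u + t *\<^sub>R v) - ?Du (x + a *\<^sub>R u + 0 *\<^sub>R v) = t * ?\<psi> b" by auto
  show ?thesis
  proof (intro exI conjI)
    show "f (x + t *\<^sub>R u + t *\<^sub>R v) - f (x + t *\<^sub>R u) - f (x + t *\<^sub>R v) + f x = t\<^sup>2 * ?\<psi> b"
      using a(3) b(3) by (simp add: power2_eq_square)
  qed (use a b in auto)
qed

text \<open>The second difference of \<open>f\<close> over a small parallelogram is symmetric in
  \<open>u\<close> and \<open>v\<close>. By the mean value theorem it equals
  \<open>t\<^sup>2\<close> times either mixed derivative at some nearby point, so by continuity the
  two cannot differ at \<open>x\<close>.\<close>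

lemma symmetric_second_derivative_real:
  fixes f :: "'a::euclidean_space \<Rightarrow> real"
  assumes "open U" and sm: "smooth_on U f" and "x \<in> U"
  shows "frechet_derivative (\<lambda>y. frechet_derivative f (at y) u) (at x) v
       = frechet_derivative (\<lambda>y. frechet_derivative f (at y) v) (at x) u"
proof (rule ccontr)
  define P Q where "P = (\<lambda>y. frechet_derivative (\<lambda>y. frechet_derivative f (at y) u) (at y) v)"
    and "Q = (\<lambda>y. frechet_derivative (\<lambda>y. frechet_derivative f (at y) v) (at y) u)"
  assume neq: "\<not> ?thesis"
  define \<epsilon> where "\<epsilon> = \<bar>P x - Q x\<bar> / 2"
  have "\<epsilon> > 0" using neq by (simp add: \<epsilon>_def P_def Q_def)
  have "continuous_on U P" "continuous_on U Q"
    unfolding P_def Q_def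
    by (intro smooth_onD_continuous smooth_on_frechet_derivative sm)+
  then have "isCont P x" "isCont Q x"
    using \<open>open U\<close> \<open>x \<in> U\<close> by (auto simp: continuous_on_eq_continuous_at)
  then have "\<exists>p>0. \<forall>y. dist y x < p \<longrightarrow> dist (P y) (P x) < \<epsilon>"
    "\<exists>q>0. \<forall>y. dist y x < q \<longrightarrow> dist (Q y) (Q x) < \<epsilon>"
    using \<open>\<epsilon> > 0\<close> by (auto simp only: continuous_at_eps_delta)
  then obtain p q where "p > 0" "q > 0"
    and p: "\<And>y. dist y x < p \<Longrightarrow> dist (P y) (P x) < \<epsilon>"
    and q: "\<And>y. dist y x < q \<Longrightarrow> dist (Q y) (Q x) < \<epsilon>"
    by blast
  obtain s where "s > 0" and s: "\<And>y. dist y x < s \<Longrightarrow> y \<in> U"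
    using \<open>open U\<close> \<open>x \<in> U\<close> unfolding open_dist by blast
  define r where "r = min s (min p q)"
  have "r > 0" using \<open>p > 0\<close> \<open>q > 0\<close> \<open>s > 0\<close> by (simp add: r_def)
  have r: "dist (P y) (P x) < \<epsilon> \<and> dist (Q y) (Q x) < \<epsilon> \<and> y \<in> U" if "dist y x < r" for y
    using that p q s by (simp add: r_def)
  \<comment> \<open>This size keeps the whole parallelogram within distance \<open>r / 2\<close> of
    \<open>x\<close>; the summand 1 keeps the denominator positive when both directions
    vanish.\<close>
  define t where "t = r / (2 * (norm u + norm v + 1))"
  have pos: "norm u + norm v + 1 > 0" by (simp add: add_nonneg_pos)
  have "t > 0" using \<open>r > 0\<close> pos by (simp add: t_def)
  have near: "dist (x + a *\<^sub>R u + b *\<^sub>R v) x < r"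
    if "0 \<le> a" "a \<le> t" "0 \<le> b" "b \<le> t" for a b
  proof -
    have "dist (x + a *\<^sub>R u + b *\<^sub>R v) x = norm (a *\<^sub>R u + b *\<^sub>R v)" by (simp add: dist_norm add.assoc)
    also have "\<dots> \<le> a * norm u + b * norm v"
      using norm_triangle_ineq[of "a *\<^sub>R u" "b *\<^sub>R v"] that by simp
    also have "\<dots> \<le> t * norm u + t * norm v"
      using that by (intro add_mono mult_right_mono) auto
    also have "\<dots> \<le> t * (norm u + norm v + 1)" using \<open>t > 0\<close> by (simp add: algebra_simps)
    also have "\<dots> = r / 2" using pos unfolding t_def by (simp add: divide_simps)
    finally show ?thesis using \<open>r > 0\<close> by simp
  qed
  have inU: "x + a *\<^sub>R u + b *\<^sub>R v \<in> U" "x + b *\<^sub>R v + a *\<^sub>R u \<in> U"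
    if "0 \<le> a" "a \<le> t" "0 \<le> b" "b \<le> t" for a b
    using r[OF near[OF that]] by (simp_all add: add_ac)
  have "\<exists>a b. 0 \<le> a \<and> a \<le> t \<and> 0 \<le> b \<and> b \<le> t \<and>
      f (x + t *\<^sub>R u + t *\<^sub>R v) - f (x + t *\<^sub>R u) - f (x + t *\<^sub>R v) + f x
        = t\<^sup>2 * P (x + a *\<^sub>R u + b *\<^sub>R v)"
    unfolding P_def by (rule second_difference_mvt[OF sm \<open>t > 0\<close>]) (rule inU)
  then obtain a b where ab: "0 \<le> a" "a \<le> t" "0 \<le> b" "b \<le> t"
    and P: "f (x + t *\<^sub>R u + t *\<^sub>R v) - f (x + t *\<^sub>R u) - f (x + t *\<^sub>R v) + f x
      = t\<^sup>2 * P (x + a *\<^sub>R u + b *\<^sub>R v)"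
    by blast
  have "\<exists>b a. 0 \<le> b \<and> b \<le> t \<and> 0 \<le> a \<and> a \<le> t \<and>
      f (x + t *\<^sub>R v + t *\<^sub>R u) - f (x + t *\<^sub>R v) - f (x + t *\<^sub>R u) + f x
        = t\<^sup>2 * Q (x + b *\<^sub>R v + a *\<^sub>R u)"
    unfolding Q_def by (rule second_difference_mvt[OF sm \<open>t > 0\<close>]) (rule inU)
  then obtain b' a' where ab': "0 \<le> a'" "a' \<le> t" "0 \<le> b'" "b' \<le> t"
    and Q: "f (x + t *\<^sub>R v + t *\<^sub>R u) - f (x + t *\<^sub>R v) - f (x + t *\<^sub>R u) + f x
      = t\<^sup>2 * Q (x + b' *\<^sub>R v + a' *\<^sub>R u)"
    by blast
  have "t\<^sup>2 * P (x + a *\<^sub>R u + b *\<^sub>R v) = t\<^sup>2 * Q (x + b' *\<^sub>R v + a' *\<^sub>R u)"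
    unfolding P[symmetric] Q[symmetric] by (simp add: algebra_simps)
  then have "P (x + a *\<^sub>R u + b *\<^sub>R v) = Q (x + a' *\<^sub>R u + b' *\<^sub>R v)"
    using \<open>t > 0\<close> by (simp add: add_ac)
  moreover have "dist (P (x + a *\<^sub>R u + b *\<^sub>R v)) (P x) < \<epsilon>"
    "dist (Q (x + a' *\<^sub>R u + b' *\<^sub>R v)) (Q x) < \<epsilon>"
    using r[OF near[OF ab]] r[OF near[OF ab']] by simp_all
  ultimately have "\<bar>P x - Q x\<bar> < \<epsilon> + \<epsilon>"
    unfolding dist_real_def by linarith
  then show False by (simp add: \<epsilon>_def)
qed

text \<open>Taking the inner product with a basis vector commutes with differentiation, which
  reduces the claim to real-valued functions.\<close>

lemma symmetric_second_derivative:
  fixes f :: "'a::euclidean_space \<Rightarrow> 'b::euclidean_space"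
  assumes "open U" and sm: "smooth_on U f" and "x \<in> U"
  shows "frechet_derivative (\<lambda>y. frechet_derivative f (at y) u) (at x) v
       = frechet_derivative (\<lambda>y. frechet_derivative f (at y) v) (at x) u"
proof (rule euclidean_eqI)
  fix b :: 'b
  let ?f = "\<lambda>y. f y \<bullet> b"
  have smb: "smooth_on U ?f"
    by (intro smooth_on_bounded_linear[OF _ bounded_linear_inner_left] assms)
  have 1: "frechet_derivative f (at y) w \<bullet> b = frechet_derivative ?f (at y) w" if "y \<in> U" for y w
    by (rule frechet_derivative_eqI[symmetric], rule has_derivative_inner_left,
        rule smooth_onD_has_derivative[OF sm that])
  have 2: "frechet_derivative (\<lambda>y. frechet_derivative f (at y) w) (at x) w' \<bullet> b
      = frechet_derivative (\<lambda>y. frechet_derivative ?f (at y) w) (at x) w'" for w w'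
  proof -
    have D: "((\<lambda>y. frechet_derivative f (at y) w \<bullet> b) has_derivative
        (\<lambda>w'. frechet_derivative (\<lambda>y. frechet_derivative f (at y) w) (at x) w' \<bullet> b)) (at x)"
      by (intro has_derivative_inner_left smooth_onD_has_derivative[OF smooth_on_frechet_derivative[OF sm]] \<open>x \<in> U\<close>)
    show ?thesis
      by (rule frechet_derivative_eqI[symmetric],
          rule has_derivative_transform_within_open[OF D \<open>open U\<close> \<open>x \<in> U\<close>]) (rule 1)
  qed
  show "frechet_derivative (\<lambda>y. frechet_derivative f (at y) u) (at x) v \<bullet> b
      = frechet_derivative (\<lambda>y. frechet_derivative f (at y) v) (at x) u \<bullet> b"
    unfolding 2 by (rule symmetric_second_derivative_real[OF \<open>open U\<close> smb \<open>x \<in> U\<close>])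
qed

subsection \<open>Uniqueness of the Levi-Civita connection\<close>

lemma levi_civita_torsion_free:
  assumes "is_levi_civita U g N" "smooth_on U X" "smooth_on U Y" "x \<in> U"
  shows "N X Y x - N Y X x = lie_bracket X Y x"
proof -
  have "\<forall>X Y. smooth_on U X \<longrightarrow> smooth_on U Y \<longrightarrow>
      (\<forall>x\<in>U. N X Y x - N Y X x = lie_bracket X Y x)"
    using assms(1) unfolding is_levi_civita_def by (elim conjE)
  from this[rule_format, OF assms(2-4)] show ?thesis .
qed

lemma levi_civita_compatible:
  assumes "is_levi_civita U g N" "smooth_on U X" "smooth_on U Y" "smooth_on U Z" "x \<in> U"
  shows "dir_deriv X (\<lambda>y. g y (Y y) (Z y)) x = g x (N X Y x) (Z x) + g x (Y x) (N X Z x)"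
proof -
  have "\<forall>X Y Z. smooth_on U X \<longrightarrow> smooth_on U Y \<longrightarrow> smooth_on U Z \<longrightarrow>
      (\<forall>x\<in>U. dir_deriv X (\<lambda>y. g y (Y y) (Z y)) x
        = g x (N X Y x) (Z x) + g x (Y x) (N X Z x))"
    using assms(1) unfolding is_levi_civita_def by (elim conjE)
  from this[rule_format, OF assms(2-5)] show ?thesis .
qed

text \<open>The difference \<open>T\<close> of the two connections is symmetric because the torsions
  agree, and skew with respect to \<open>g\<close> because both are metric. Alternating the two
  properties returns to the starting term after three sign changes, so the term vanishes.\<close>

lemma levi_civita_unique:
  assumes g: "riemannian_metric_on U g"
    and N: "is_levi_civita U g N" and N': "is_levi_civita U g N'"
    and X: "smooth_on U X" and Y: "smooth_on U Y" and x: "x \<in> U"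
  shows "N X Y x = N' X Y x"
proof -
  define T where "T = (\<lambda>A B. N A B x - N' A B x)"
  have sym: "T A B = T B A" if "smooth_on U A" "smooth_on U B" for A B
  proof -
    have "N A B x - N B A x = N' A B x - N' B A x"
      using levi_civita_torsion_free[OF N that x] levi_civita_torsion_free[OF N' that x] by simp
    then show ?thesis unfolding T_def by (simp add: algebra_simps)
  qed
  have bil: "bilinear (g x)" and comm: "\<And>u v. g x u v = g x v u"
    and posd: "\<And>v. v \<noteq> 0 \<Longrightarrow> g x v v > 0"
    using g x unfolding riemannian_metric_on_def by blast+
  have skew: "g x (T A B) (C x) = - g x (T A C) (B x)"
    if "smooth_on U A" "smooth_on U B" "smooth_on U C" for A B C
  proof -
    have "g x (N A B x) (C x) + g x (B x) (N A C x) = g x (N' A B x) (C x) + g x (B x) (N' A C x)"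
      using levi_civita_compatible[OF N that x] levi_civita_compatible[OF N' that x] by simp
    then show ?thesis
      unfolding T_def bilinear_lsub[OF bil] comm[of "B x"] by simp
  qed
  \<comment> \<open>A constant field with value \<open>T X Y\<close> is smooth, so the skew symmetry
    may be tested against this vector itself, and positive definiteness at \<open>x\<close>
    concludes.\<close>
  define Z :: "'a vfield" where "Z = (\<lambda>_. T X Y)"
  have Z: "smooth_on U Z" by (simp add: Z_def)
  have "g x (T X Y) (Z x) = - g x (T X Z) (Y x)" by (rule skew[OF X Y Z])
  also have "\<dots> = - g x (T Z X) (Y x)" by (simp add: sym[OF X Z])
  also have "\<dots> = g x (T Z Y) (X x)" by (simp add: skew[OF Z X Y])
  also have "\<dots> = g x (T Y Z) (X x)" by (simp add: sym[OF Y Z])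
  also have "\<dots> = - g x (T Y X) (Z x)" by (rule skew[OF Y Z X])
  also have "\<dots> = - g x (T X Y) (Z x)" by (simp add: sym[OF X Y])
  finally have "g x (T X Y) (Z x) = - g x (T X Y) (Z x)" .
  then have "g x (T X Y) (T X Y) = 0" by (simp add: Z_def)
  then have "T X Y = 0" using posd by fastforce
  then show ?thesis by (simp add: T_def)
qed

subsection \<open>The metric, its Levi-Civita connection and its Ricci tensor\<close>

lemma vec3_eqI: "u $ 1 = v $ 1 \<Longrightarrow> u $ 2 = v $ 2 \<Longrightarrow> u $ 3 = v $ 3 \<Longrightarrow> u = (v :: real ^ 3)"
  by (simp add: vec_eq_iff forall_3)

lemma axis3_nth [simp]:
  "axis 1 a $ (1::3) = a" "axis 1 a $ (2::3) = 0" "axis 1 a $ (3::3) = 0"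
  "axis 2 a $ (1::3) = 0" "axis 2 a $ (2::3) = a" "axis 2 a $ (3::3) = 0"
  "axis 3 a $ (1::3) = 0" "axis 3 a $ (2::3) = 0" "axis 3 a $ (3::3) = a"
  by (simp_all add: axis_def)

text \<open>
  The functions \<open>h\<close> and \<open>d\<close> are the logarithmic derivatives of \<open>f1\<close> along \<open>x\<^sup>2\<close> and of \<open>f2\<close> along
  \<open>x\<^sup>3\<close>, regarded as functions on \<open>U\<close>; \<open>dh\<close> and \<open>dd\<close> are their derivatives.
\<close>

locale diagonal_metric =
  fixes U :: "(real ^ 3) set" and f1 f2 h d dh dd :: "real ^ 3 \<Rightarrow> real"
  assumes open_U: "open U"
    and smooth: "smooth_on U f1" "smooth_on U f2" "smooth_on U h" "smooth_on U d"
    and nonzero: "\<And>x. x \<in> U \<Longrightarrow> f1 x \<noteq> 0" "\<And>x. x \<in> U \<Longrightarrow> f2 x \<noteq> 0"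
    and f1_has_derivative: "\<And>x. x \<in> U \<Longrightarrow> (f1 has_derivative (\<lambda>v. f1 x * h x * v $ 2)) (at x)"
    and f2_has_derivative: "\<And>x. x \<in> U \<Longrightarrow> (f2 has_derivative (\<lambda>v. f2 x * d x * v $ 3)) (at x)"
    and h_has_derivative: "\<And>x. x \<in> U \<Longrightarrow> (h has_derivative (\<lambda>v. dh x * v $ 2)) (at x)"
    and d_has_derivative: "\<And>x. x \<in> U \<Longrightarrow> (d has_derivative (\<lambda>v. dd x * v $ 3)) (at x)"
begin

abbreviation g :: "3 metric" where "g \<equiv> g_tilde f1 f2"

text \<open>The Christoffel symbols of \<open>g\<close> in the coordinate frame, contracted with two
  tangent vectors. Derivatives of \<open>f1\<close> and \<open>f2\<close> are expressed through
  \<open>h\<close> and \<open>d\<close>.\<close>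

definition christoffel :: "real ^ 3 \<Rightarrow> real ^ 3 \<Rightarrow> real ^ 3 \<Rightarrow> real ^ 3" where
  "christoffel x u v =
     (- (h x * (u $ 1 * v $ 2 + u $ 2 * v $ 1))) *\<^sub>R axis 1 1 +
     (h x * (f2 x)\<^sup>2 / (f1 x)\<^sup>2 * (u $ 1 * v $ 1) - d x * (u $ 2 * v $ 3 + u $ 3 * v $ 2)) *\<^sub>R axis 2 1 +
     (d x / (f2 x)\<^sup>2 * (u $ 2 * v $ 2)) *\<^sub>R axis 3 1"

text \<open>The derivative of the Christoffel symbols in direction \<open>w\<close>, with the
  arguments \<open>u\<close> and \<open>v\<close> held fixed.\<close>

definition christoffel_deriv :: "real ^ 3 \<Rightarrow> real ^ 3 \<Rightarrow> real ^ 3 \<Rightarrow> real ^ 3 \<Rightarrow> real ^ 3" where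
  "christoffel_deriv x w u v =
     (- (dh x * w $ 2 * (u $ 1 * v $ 2 + u $ 2 * v $ 1))) *\<^sub>R axis 1 1 +
     ((dh x * w $ 2 + 2 * h x * d x * w $ 3 - 2 * (h x)\<^sup>2 * w $ 2) * (f2 x)\<^sup>2 / (f1 x)\<^sup>2 * (u $ 1 * v $ 1)
        - dd x * w $ 3 * (u $ 2 * v $ 3 + u $ 3 * v $ 2)) *\<^sub>R axis 2 1 +
     ((dd x - 2 * (d x)\<^sup>2) * w $ 3 / (f2 x)\<^sup>2 * (u $ 2 * v $ 2)) *\<^sub>R axis 3 1"

definition connection :: "3 vfield \<Rightarrow> 3 vfield \<Rightarrow> 3 vfield" where
  "connection X Y x = frechet_derivative Y (at x) (X x) + christoffel x (X x) (Y x)"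

lemma christoffel_nth [simp]:
  "christoffel x u v $ 1 = - (h x * (u $ 1 * v $ 2 + u $ 2 * v $ 1))"
  "christoffel x u v $ 2 = h x * (f2 x)\<^sup>2 / (f1 x)\<^sup>2 * (u $ 1 * v $ 1) - d x * (u $ 2 * v $ 3 + u $ 3 * v $ 2)"
  "christoffel x u v $ 3 = d x / (f2 x)\<^sup>2 * (u $ 2 * v $ 2)"
  by (simp_all add: christoffel_def)

lemma christoffel_deriv_nth [simp]:
  "christoffel_deriv x w u v $ 1 = - (dh x * w $ 2 * (u $ 1 * v $ 2 + u $ 2 * v $ 1))"
  "christoffel_deriv x w u v $ 2 =
    (dh x * w $ 2 + 2 * h x * d x * w $ 3 - 2 * (h x)\<^sup>2 * w $ 2) * (f2 x)\<^sup>2 / (f1 x)\<^sup>2 * (u $ 1 * v $ 1)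
        - dd x * w $ 3 * (u $ 2 * v $ 3 + u $ 3 * v $ 2)"
  "christoffel_deriv x w u v $ 3 = (dd x - 2 * (d x)\<^sup>2) * w $ 3 / (f2 x)\<^sup>2 * (u $ 2 * v $ 2)"
  by (simp_all add: christoffel_deriv_def)

lemma christoffel_bilinear:
  "christoffel x (u + u') v = christoffel x u v + christoffel x u' v"
  "christoffel x (u - u') v = christoffel x u v - christoffel x u' v"
  "christoffel x (c *\<^sub>R u) v = c *\<^sub>R christoffel x u v"
  "christoffel x u (v + v') = christoffel x u v + christoffel x u v'"
  "christoffel x u (c *\<^sub>R v) = c *\<^sub>R christoffel x u v"
  by (rule vec3_eqI; simp add: algebra_simps add_divide_distrib diff_divide_distrib)+

lemma christoffel_commute: "christoffel x u v = christoffel x v u"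
  by (rule vec3_eqI) (simp_all add: algebra_simps)

lemma vfield_nth_has_derivative:
  assumes "smooth_on U Y" "x \<in> U"
  shows "((\<lambda>y. Y y $ i) has_derivative (\<lambda>v. frechet_derivative Y (at x) v $ i)) (at x)"
  by (rule bounded_linear.has_derivative[OF bounded_linear_vec_nth smooth_onD_has_derivative[OF assms]])

text \<open>Product rule: the three summands come from the coefficients and from each of the two
  arguments.\<close>

lemma christoffel_has_derivative:
  assumes x: "x \<in> U" and Y: "smooth_on U Y" and Z: "smooth_on U Z"
  shows "((\<lambda>y. christoffel y (Y y) (Z y)) has_derivative
    (\<lambda>w. christoffel_deriv x w (Y x) (Z x)
       + christoffel x (frechet_derivative Y (at x) w) (Z x)
       + christoffel x (Y x) (frechet_derivative Z (at x) w))) (at x)"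
proof -
  note D = f1_has_derivative[OF x] f2_has_derivative[OF x] h_has_derivative[OF x] d_has_derivative[OF x]
    vfield_nth_has_derivative[OF Y x] vfield_nth_has_derivative[OF Z x]
  note nz = nonzero[OF x]
  let ?DY = "frechet_derivative Y (at x)" and ?DZ = "frechet_derivative Z (at x)"
  have 1: "((\<lambda>y. - (h y * (Y y $ 1 * Z y $ 2 + Y y $ 2 * Z y $ 1))) has_derivative
      (\<lambda>w. (christoffel_deriv x w (Y x) (Z x) + christoffel x (?DY w) (Z x)
        + christoffel x (Y x) (?DZ w)) $ 1)) (at x)"
    by (rule derivative_eq_intros D refl)+ (simp add: algebra_simps)
  have 2: "((\<lambda>y. h y * (f2 y)\<^sup>2 / (f1 y)\<^sup>2 * (Y y $ 1 * Z y $ 1) - d y * (Y y $ 2 * Z y $ 3 + Y y $ 3 * Z y $ 2))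
      has_derivative (\<lambda>w. (christoffel_deriv x w (Y x) (Z x) + christoffel x (?DY w) (Z x)
        + christoffel x (Y x) (?DZ w)) $ 2)) (at x)"
    by (rule derivative_eq_intros D refl | simp add: nz)+
      (simp add: fun_eq_iff field_simps nz power2_eq_square)
  have 3: "((\<lambda>y. d y / (f2 y)\<^sup>2 * (Y y $ 2 * Z y $ 2))
      has_derivative (\<lambda>w. (christoffel_deriv x w (Y x) (Z x) + christoffel x (?DY w) (Z x)
        + christoffel x (Y x) (?DZ w)) $ 3)) (at x)"
    by (rule derivative_eq_intros D refl | simp add: nz)+
      (simp add: fun_eq_iff field_simps nz power2_eq_square)
  \<comment> \<open>The components are differentiated separately as real functions; this identity
    reassembles the vector-valued derivative.\<close>
  have expand: "v $ 1 *\<^sub>R axis 1 1 + v $ 2 *\<^sub>R axis 2 1 + v $ 3 *\<^sub>R axis 3 1 = v" for v :: "real ^ 3"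
    by (rule vec3_eqI) simp_all
  have "((\<lambda>y. christoffel y (Y y) (Z y)) has_derivative (\<lambda>w.
       (christoffel_deriv x w (Y x) (Z x) + christoffel x (?DY w) (Z x)
        + christoffel x (Y x) (?DZ w)) $ 1 *\<^sub>R axis 1 1
      + (christoffel_deriv x w (Y x) (Z x) + christoffel x (?DY w) (Z x)
        + christoffel x (Y x) (?DZ w)) $ 2 *\<^sub>R axis 2 1
      + (christoffel_deriv x w (Y x) (Z x) + christoffel x (?DY w) (Z x)
        + christoffel x (Y x) (?DZ w)) $ 3 *\<^sub>R axis 3 1)) (at x)"
    unfolding christoffel_def[of _ "Y _" "Z _"]
    by (intro has_derivative_add has_derivative_scaleR_left 1 2 3)
  then show ?thesis unfolding expand .
qed

lemma smooth_on_connection: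
  assumes "smooth_on U X" "smooth_on U Y"
  shows "smooth_on U (connection X Y)"
  unfolding connection_def christoffel_def
  by (intro smooth_on_intros open_U assms smooth) (auto simp: nonzero)

section \<open>The metric and its orthonormal frame\<close>

lemma metric_smooth:
  "smooth_on U Y \<Longrightarrow> smooth_on U Z \<Longrightarrow> smooth_on U (\<lambda>x. g x (Y x) (Z x))"
  unfolding g_tilde_def
  by (intro smooth_on_intros open_U smooth) (auto simp: nonzero)

lemma riemannian_metric: "riemannian_metric_on U g"
  unfolding riemannian_metric_on_def
proof (intro conjI ballI allI impI)
  fix x assume x: "x \<in> U"
  show "bilinear (g x)"
    unfolding bilinear_def
    by (intro conjI allI linearI) (simp_all add: g_tilde_def algebra_simps)
  show "g x u v = g x v u" for u v
    by (simp add: g_tilde_def algebra_simps)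
  fix v :: "real ^ 3" assume "v \<noteq> 0"
  then have "v $ 1 \<noteq> 0 \<or> v $ 2 \<noteq> 0 \<or> v $ 3 \<noteq> 0" by (auto simp: vec_eq_iff forall_3)
  moreover have "g x v v = (v $ 1 / f1 x)\<^sup>2 + (v $ 2 / f2 x)\<^sup>2 + (v $ 3)\<^sup>2"
    by (simp add: g_tilde_def power_divide power2_eq_square)
  ultimately show "g x v v > 0"
    using nonzero[OF x] by (auto simp: add_pos_nonneg add_nonneg_pos)
next
  show "smooth_on U (\<lambda>x. g x u v)" for u v
    by (intro metric_smooth smooth_on_const)
qed

lemma orthonormal_frame: "orthonormal_frame_on U g (E_frame f1 f2)"
  unfolding orthonormal_frame_on_def
proof (intro conjI ballI allI)
  fix i :: 3
  have "E_frame f1 f2 1 = (\<lambda>x. f1 x *\<^sub>R axis 1 1)" "E_frame f1 f2 2 = (\<lambda>x. f2 x *\<^sub>R axis 2 1)"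
    "E_frame f1 f2 3 = (\<lambda>x. axis 3 1)"
    by (simp_all add: E_frame_def fun_eq_iff)
  then show "smooth_on U (E_frame f1 f2 i)"
    using exhaust_3[of i] by (auto intro!: smooth_on_scaleR[OF open_U] smooth_on_const smooth)
next
  fix x i j assume "x \<in> U"
  then show "g x (E_frame f1 f2 i x) (E_frame f1 f2 j x) = (if i = j then 1 else 0)"
    using exhaust_3[of i] exhaust_3[of j] nonzero[of x]
    by (auto simp: E_frame_def g_tilde_def power2_eq_square)
qed

section \<open>Metric compatibility and the explicit connection\<close>

lemma dir_deriv_metric:
  assumes x: "x \<in> U" and Y: "smooth_on U Y" and Z: "smooth_on U Z"
  shows "dir_deriv X (\<lambda>y. g y (Y y) (Z y)) x =
    - 2 * h x * X x $ 2 / (f1 x)\<^sup>2 * (Y x $ 1 * Z x $ 1) - 2 * d x * X x $ 3 / (f2 x)\<^sup>2 * (Y x $ 2 * Z x $ 2)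
    + g x (frechet_derivative Y (at x) (X x)) (Z x) + g x (Y x) (frechet_derivative Z (at x) (X x))"
  unfolding dir_deriv_def
proof (rule frechet_derivative_eqI)
  note D = f1_has_derivative[OF x] f2_has_derivative[OF x]
    vfield_nth_has_derivative[OF Y x] vfield_nth_has_derivative[OF Z x]
  note nz = nonzero[OF x]
  let ?DY = "frechet_derivative Y (at x)" and ?DZ = "frechet_derivative Z (at x)"
  show "((\<lambda>y. g y (Y y) (Z y)) has_derivative (\<lambda>v.
    - 2 * h x * v $ 2 / (f1 x)\<^sup>2 * (Y x $ 1 * Z x $ 1) - 2 * d x * v $ 3 / (f2 x)\<^sup>2 * (Y x $ 2 * Z x $ 2)
    + g x (?DY v) (Z x) + g x (Y x) (?DZ v))) (at x)"
    unfolding g_tilde_def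
    by (rule derivative_eq_intros D refl | simp add: nz)+
      (simp add: fun_eq_iff field_simps nz power2_eq_square)
qed

lemma linear_deriv: "smooth_on U Y \<Longrightarrow> x \<in> U \<Longrightarrow> linear (frechet_derivative Y (at x))"
  using linear_frechet_derivative smooth_onD_differentiable by blast

text \<open>Linearity and the Leibniz rule come from the derivative part of
  \<open>connection\<close>. Torsion vanishes since \<open>christoffel\<close> is symmetric, and its
  terms account for the derivatives of \<open>1 / f1\<^sup>2\<close> and
  \<open>1 / f2\<^sup>2\<close> in the metric.\<close>

lemma connection_is_levi_civita: "is_levi_civita U g connection"
  unfolding is_levi_civita_def affine_connection_on_def
proof (intro conjI allI impI ballI)
  fix X Y :: "3 vfield" and x assume X: "smooth_on U X" and Y: "smooth_on U Y"
  show "smooth_on U (connection X Y)" by (rule smooth_on_connection[OF X Y])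
  assume x: "x \<in> U"
  show "connection X Y x - connection Y X x = lie_bracket X Y x"
    by (simp add: connection_def lie_bracket_def christoffel_commute[of x "X x"])
next
  fix X X' Y :: "3 vfield" and x assume "smooth_on U X" "smooth_on U X'" and Y: "smooth_on U Y" and x: "x \<in> U"
  show "connection (\<lambda>y. X y + X' y) Y x = connection X Y x + connection X' Y x"
    by (simp add: connection_def christoffel_bilinear linear_add[OF linear_deriv[OF Y x]])
next
  fix f :: "real ^ 3 \<Rightarrow> real" and X Y :: "3 vfield" and x assume "smooth_on U f" "smooth_on U X" and Y: "smooth_on U Y" and x: "x \<in> U"
  show "connection (\<lambda>y. f y *\<^sub>R X y) Y x = f x *\<^sub>R connection X Y x"
    by (simp add: connection_def christoffel_bilinear linear_scale[OF linear_deriv[OF Y x]]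
        scaleR_add_right)
next
  fix X Y Y' :: "3 vfield" and x assume Y: "smooth_on U Y" "smooth_on U Y'" and x: "x \<in> U"
  have "frechet_derivative (\<lambda>y. Y y + Y' y) (at x) v
      = frechet_derivative Y (at x) v + frechet_derivative Y' (at x) v" for v
    by (rule frechet_derivative_eqI)
      (rule has_derivative_add[OF Y[THEN smooth_onD_has_derivative, OF x]])
  then show "connection X (\<lambda>y. Y y + Y' y) x = connection X Y x + connection X Y' x"
    by (simp add: connection_def christoffel_bilinear)
next
  fix f :: "real ^ 3 \<Rightarrow> real" and X Y :: "3 vfield" and x assume f: "smooth_on U f" and Y: "smooth_on U Y" and x: "x \<in> U"
  have "frechet_derivative (\<lambda>y. f y *\<^sub>R Y y) (at x) v
      = f x *\<^sub>R frechet_derivative Y (at x) v + frechet_derivative f (at x) v *\<^sub>R Y x" for v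
    by (rule frechet_derivative_eqI)
      (rule has_derivative_scaleR[OF smooth_onD_has_derivative[OF f x] smooth_onD_has_derivative[OF Y x]])
  then show "connection X (\<lambda>y. f y *\<^sub>R Y y) x = dir_deriv X f x *\<^sub>R Y x + f x *\<^sub>R connection X Y x"
    by (simp add: connection_def christoffel_bilinear dir_deriv_def scaleR_add_right)
next
  fix X Y Z :: "3 vfield" and x assume Y: "smooth_on U Y" and Z: "smooth_on U Z" and x: "x \<in> U"
  show "dir_deriv X (\<lambda>y. g y (Y y) (Z y)) x
      = g x (connection X Y x) (Z x) + g x (Y x) (connection X Z x)"
    unfolding dir_deriv_metric[OF x Y Z] unfolding connection_def g_tilde_def
    by (simp add: field_simps nonzero[OF x] power2_eq_square)
qed

section \<open>Identification of the chosen connection, curvature and Ricci tensor\<close>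

lemma levi_civita_is_levi_civita: "is_levi_civita U g (levi_civita U g)"
  unfolding levi_civita_def by (rule someI[of "is_levi_civita U g", OF connection_is_levi_civita])

lemma levi_civita_eq:
  "smooth_on U X \<Longrightarrow> smooth_on U Y \<Longrightarrow> x \<in> U \<Longrightarrow> levi_civita U g X Y x = connection X Y x"
  by (rule levi_civita_unique[OF riemannian_metric levi_civita_is_levi_civita connection_is_levi_civita])

text \<open>The inner field agrees with \<open>connection Y Z\<close> only on \<open>U\<close>.
  Openness carries over both its smoothness and its derivative at \<open>x\<close>.\<close>

lemma levi_civita_twice:
  assumes X: "smooth_on U X" and Y: "smooth_on U Y" and Z: "smooth_on U Z" and x: "x \<in> U"
  shows "levi_civita U g X (levi_civita U g Y Z) x = connection X (connection Y Z) x"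
proof -
  have eq: "connection Y Z y = levi_civita U g Y Z y" if "y \<in> U" for y
    using levi_civita_eq[OF Y Z that] by simp
  have sm: "smooth_on U (connection Y Z)" by (rule smooth_on_connection[OF Y Z])
  have "smooth_on U (levi_civita U g Y Z)" by (rule smooth_on_cong[OF open_U eq sm])
  then have "levi_civita U g X (levi_civita U g Y Z) x = connection X (levi_civita U g Y Z) x"
    by (rule levi_civita_eq[OF X _ x])
  also have "\<dots> = connection X (connection Y Z) x"
    using frechet_derivative_transform_within_open[OF smooth_onD_differentiable[OF sm x] open_U x eq]
    by (simp add: connection_def[of X] eq[OF x])
  finally show ?thesis .
qed

lemma connection_twice:
  assumes X: "smooth_on U X" and Y: "smooth_on U Y" and Z: "smooth_on U Z" and x: "x \<in> U"
  shows "connection X (connection Y Z) x =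
    frechet_derivative (\<lambda>y. frechet_derivative Z (at y) (Y x)) (at x) (X x)
    + frechet_derivative Z (at x) (frechet_derivative Y (at x) (X x))
    + christoffel_deriv x (X x) (Y x) (Z x)
    + christoffel x (frechet_derivative Y (at x) (X x)) (Z x)
    + christoffel x (Y x) (frechet_derivative Z (at x) (X x))
    + christoffel x (X x) (frechet_derivative Z (at x) (Y x))
    + christoffel x (X x) (christoffel x (Y x) (Z x))"
proof -
  have "frechet_derivative (connection Y Z) (at x) v =
      frechet_derivative (\<lambda>y. frechet_derivative Z (at y) (Y x)) (at x) v
    + frechet_derivative Z (at x) (frechet_derivative Y (at x) v)
    + (christoffel_deriv x v (Y x) (Z x)
    + christoffel x (frechet_derivative Y (at x) v) (Z x)
    + christoffel x (Y x) (frechet_derivative Z (at x) v))" for v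
    unfolding connection_def
    by (rule frechet_derivative_eqI)
      (rule has_derivative_add[OF has_derivative_frechet_derivative_along[OF open_U x Y Z]
          christoffel_has_derivative[OF x Y Z]])
  then show ?thesis
    by (simp add: connection_def[of X] connection_def[of Y Z x] christoffel_bilinear)
qed

text \<open>Second derivatives of \<open>Z\<close> cancel by symmetry, and derivatives of
  \<open>X\<close> and \<open>Y\<close> cancel against the Lie bracket term. The mixed terms with
  one derivative of \<open>Z\<close> are symmetric in \<open>X\<close> and \<open>Y\<close> and
  cancel too, leaving an expression in the values of the fields at \<open>x\<close>.\<close>

lemma curvature_levi_civita:
  assumes X: "smooth_on U X" and Y: "smooth_on U Y" and Z: "smooth_on U Z" and x: "x \<in> U"
  shows "curvature (levi_civita U g) X Y Z x =
    christoffel_deriv x (X x) (Y x) (Z x) - christoffel_deriv x (Y x) (X x) (Z x)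
    + christoffel x (X x) (christoffel x (Y x) (Z x))
    - christoffel x (Y x) (christoffel x (X x) (Z x))"
proof -
  have "levi_civita U g (lie_bracket X Y) Z x = connection (lie_bracket X Y) Z x"
    by (rule levi_civita_eq[OF smooth_on_lie_bracket[OF open_U X Y] Z x])
  also have "\<dots> = frechet_derivative Z (at x) (frechet_derivative Y (at x) (X x))
      - frechet_derivative Z (at x) (frechet_derivative X (at x) (Y x))
      + christoffel x (frechet_derivative Y (at x) (X x)) (Z x)
      - christoffel x (frechet_derivative X (at x) (Y x)) (Z x)"
    by (simp add: connection_def lie_bracket_def christoffel_bilinear
        linear_diff[OF linear_deriv[OF Z x]])
  finally have "levi_civita U g (lie_bracket X Y) Z x = \<dots>" .
  moreover have "frechet_derivative (\<lambda>y. frechet_derivative Z (at y) (Y x)) (at x) (X x)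
      = frechet_derivative (\<lambda>y. frechet_derivative Z (at y) (X x)) (at x) (Y x)"
    by (rule symmetric_second_derivative[OF open_U Z x])
  ultimately show ?thesis
    by (simp add: curvature_def levi_civita_twice connection_twice X Y Z x)
qed

text \<open>The frame fields are smooth, so the pointwise curvature formula applies to each term of
  the trace. Coefficients refer to coordinate components, whence the divisions by
  \<open>(f1 x)\<^sup>2\<close> and \<open>(f2 x)\<^sup>2\<close>.\<close>

lemma ricci_eq:
  assumes Y: "smooth_on U Y" and Z: "smooth_on U Z" and x: "x \<in> U"
  shows "ricci U g (E_frame f1 f2) Y Z x =
    (f2 x)\<^sup>2 * (dh x - (h x)\<^sup>2) / (f1 x)\<^sup>2 * (Y x $ 1 * Z x $ 1)
    + ((f2 x)\<^sup>2 * (dh x - (h x)\<^sup>2) + dd x - (d x)\<^sup>2) / (f2 x)\<^sup>2 * (Y x $ 2 * Z x $ 2)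
    + (dd x - (d x)\<^sup>2) * (Y x $ 3 * Z x $ 3)
    + d x * h x * (Y x $ 2 * Z x $ 3 + Y x $ 3 * Z x $ 2)"
proof -
  have "smooth_on U (E_frame f1 f2 k)" for k
    using orthonormal_frame unfolding orthonormal_frame_on_def by blast
  then show ?thesis
    unfolding ricci_def sum_3 curvature_levi_civita[OF _ Y Z x]
    by (simp add: curvature_levi_civita[OF _ Y Z x] g_tilde_def E_frame_def)
      (simp add: field_simps nonzero[OF x] power2_eq_square)
qed

section \<open>The Lie derivative and the components of the soliton equation\<close>

lemma lie_derivative_metric_eq:
  assumes Y: "smooth_on U Y" and Z: "smooth_on U Z" and x: "x \<in> U"
  shows "lie_derivative_metric d_dx3 g Y Z x = - 2 * d x / (f2 x)\<^sup>2 * (Y x $ 2 * Z x $ 2)"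
proof -
  \<comment> \<open>The field \<open>d_dx3\<close> is constant, so the bracket is the plain
    derivative along the third axis. These terms cancel in the Lie derivative, leaving only the
    derivative of \<open>1 / f2\<^sup>2\<close>.\<close>
  have "lie_bracket d_dx3 W x = frechet_derivative W (at x) (axis 3 1)" for W :: "3 vfield"
    by (simp add: lie_bracket_def d_dx3_def[abs_def])
  then show ?thesis
    unfolding lie_derivative_metric_def dir_deriv_metric[OF x Y Z] by (simp add: d_dx3_def)
qed

lemma soliton_iff:
  assumes lam: "smooth_on U lam" and mu: "smooth_on U mu" "\<exists>x\<in>U. mu x \<noteq> 0"
  shows "almost_eta_ricci_soliton U g (E_frame f1 f2) d_dx3 dx3 lam mu \<longleftrightarrow>
    (\<forall>x\<in>U. dd x = d x * (d x + 1) \<and> d x * h x = 0 \<and>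
      lam x = - (f2 x)\<^sup>2 * (dh x - (h x)\<^sup>2) \<and>
      mu x = (f2 x)\<^sup>2 * (dh x - (h x)\<^sup>2) - (dd x - (d x)\<^sup>2))"
    (is "?L \<longleftrightarrow> (\<forall>x\<in>U. ?R x)")
proof -
  let ?Q = "\<lambda>Y Z x. (1/2) * lie_derivative_metric d_dx3 g Y Z x + ricci U g (E_frame f1 f2) Y Z x
               + lam x * g x (Y x) (Z x) + mu x * (dx3 x (Y x) * dx3 x (Z x))"
  have Q: "?Q Y Z x =
      ((f2 x)\<^sup>2 * (dh x - (h x)\<^sup>2) + lam x) / (f1 x)\<^sup>2 * (Y x $ 1 * Z x $ 1)
    + ((f2 x)\<^sup>2 * (dh x - (h x)\<^sup>2) + dd x - (d x)\<^sup>2 - d x + lam x) / (f2 x)\<^sup>2 * (Y x $ 2 * Z x $ 2)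
    + (dd x - (d x)\<^sup>2 + lam x + mu x) * (Y x $ 3 * Z x $ 3)
    + d x * h x * (Y x $ 2 * Z x $ 3 + Y x $ 3 * Z x $ 2)"
    if "smooth_on U Y" "smooth_on U Z" "x \<in> U" for Y Z x
    unfolding lie_derivative_metric_eq[OF that] ricci_eq[OF that]
    by (simp add: g_tilde_def dx3_def) (simp add: algebra_simps add_divide_distrib diff_divide_distrib)
  have "?L \<longleftrightarrow> (\<forall>Y Z. smooth_on U Y \<longrightarrow> smooth_on U Z \<longrightarrow> (\<forall>x\<in>U. ?Q Y Z x = 0))"
    unfolding almost_eta_ricci_soliton_def
    using riemannian_metric orthonormal_frame lam mu
    by (simp add: smooth_one_form_on_def d_dx3_def[abs_def] dx3_def linearI)
  also have "\<dots> \<longleftrightarrow> (\<forall>x\<in>U. ?R x)"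
  proof (intro iffI ballI)
    fix x assume "\<forall>Y Z. smooth_on U Y \<longrightarrow> smooth_on U Z \<longrightarrow> (\<forall>x\<in>U. ?Q Y Z x = 0)" and x: "x \<in> U"
    then have "?Q (\<lambda>_. u) (\<lambda>_. v) x = 0" for u v
      using smooth_on_const by blast
    note * = this[unfolded Q[OF smooth_on_const smooth_on_const x]]
    \<comment> \<open>The slot 11 gives \<open>lam\<close>; subtracting it from the slot 22 leaves
      the equation for \<open>dd\<close>; the slot 33 then gives \<open>mu\<close>, and the slot 23
      gives \<open>d x * h x = 0\<close>.\<close>
    from *[of "axis 1 1" "axis 1 1"] *[of "axis 2 1" "axis 2 1"] *[of "axis 3 1" "axis 3 1"]
      *[of "axis 2 1" "axis 3 1"]
    show "?R x" using nonzero[OF x] by (simp add: algebra_simps power2_eq_square)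
  next
    assume R: "\<forall>x\<in>U. ?R x"
    show "\<forall>Y Z. smooth_on U Y \<longrightarrow> smooth_on U Z \<longrightarrow> (\<forall>x\<in>U. ?Q Y Z x = 0)"
    proof (intro allI impI ballI)
      fix Y Z :: "3 vfield" and x assume YZ: "smooth_on U Y" "smooth_on U Z" and x: "x \<in> U"
      from R x have r: "dd x = d x * (d x + 1)" "d x * h x = 0"
        "lam x = - (f2 x)\<^sup>2 * (dh x - (h x)\<^sup>2)"
        "mu x = (f2 x)\<^sup>2 * (dh x - (h x)\<^sup>2) - (dd x - (d x)\<^sup>2)" by blast+
      have "(f2 x)\<^sup>2 * (dh x - (h x)\<^sup>2) + lam x = 0"
        "(f2 x)\<^sup>2 * (dh x - (h x)\<^sup>2) + dd x - (d x)\<^sup>2 - d x + lam x = 0"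
        "dd x - (d x)\<^sup>2 + lam x + mu x = 0"
        unfolding r(1,3,4) by (simp_all add: algebra_simps power2_eq_square)
      then show "?Q Y Z x = 0"
        unfolding Q[OF YZ x] r(2) by simp
    qed
  qed
  finally show ?thesis .
qed

end

subsection \<open>Functions of one coordinate and the equation for \<open>d\<close>\<close>

text \<open>Nothing is assumed about \<open>\<phi>\<close> beyond its agreement with
  \<open>f\<close> on \<open>U\<close>. Its differentiability is recovered by restricting
  \<open>f\<close> to the line through \<open>x\<close> parallel to the axis
  \<open>i\<close>.\<close>

lemma smooth_function_of_coordinate:
  fixes f :: "real ^ 'n \<Rightarrow> real"
  assumes "open U" and sm: "smooth_on U f" and f: "\<forall>x\<in>U. f x = \<phi> (x $ i)"
  shows "smooth_on U (\<lambda>x. deriv \<phi> (x $ i))"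
    and "x \<in> U \<Longrightarrow> (\<phi> has_field_derivative deriv \<phi> (x $ i)) (at (x $ i))"
    and "x \<in> U \<Longrightarrow> (f has_derivative (\<lambda>v. deriv \<phi> (x $ i) * v $ i)) (at x)"
proof -
  have D: "(\<phi> has_field_derivative frechet_derivative f (at x) (axis i 1)) (at (x $ i))"
    if x: "x \<in> U" for x
  proof -
    let ?c = "\<lambda>t. x + (t - x $ i) *\<^sub>R axis i 1"
    have "(?c has_derivative (\<lambda>k. k *\<^sub>R axis i 1)) (at (x $ i))"
      by (auto intro!: derivative_eq_intros)
    moreover have "(f has_derivative frechet_derivative f (at x)) (at (?c (x $ i)))"
      using smooth_onD_has_derivative[OF sm x] by simp
    ultimately have "((\<lambda>t. f (?c t)) has_derivative (\<lambda>k. frechet_derivative f (at x) (k *\<^sub>R axis i 1))) (at (x $ i))"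
      by (rule has_derivative_compose)
    moreover have "frechet_derivative f (at x) (k *\<^sub>R axis i 1) = frechet_derivative f (at x) (axis i 1) * k" for k
      using linear_scale[OF linear_frechet_derivative[OF smooth_onD_differentiable[OF sm x]], of k "axis i 1"]
      by (simp add: mult.commute)
    ultimately have Dc: "((\<lambda>t. f (?c t)) has_field_derivative frechet_derivative f (at x) (axis i 1)) (at (x $ i))"
      unfolding has_field_derivative_def by simp
    have "continuous_on UNIV ?c"
      by (intro continuous_on_add continuous_on_scaleR continuous_on_diff continuous_on_id continuous_on_const)
    \<comment> \<open>On this open neighbourhood of \<open>x $ i\<close> the line stays in
      \<open>U\<close>, so \<open>\<phi>\<close> coincides there with the restriction of
      \<open>f\<close>.\<close>
    then have op: "open (?c -` U)" by (rule open_vimage[OF \<open>open U\<close>])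
    have eq: "f (?c t) = \<phi> t" if "t \<in> ?c -` U" for t
    proof -
      have "f (?c t) = \<phi> (?c t $ i)" using f that by blast
      also have "?c t $ i = t" by (simp add: axis_def)
      finally show ?thesis .
    qed
    have "x $ i \<in> ?c -` U" using x by simp
    from has_field_derivative_transform_within_open[OF Dc op this eq] show ?thesis by blast
  qed
  have eq: "frechet_derivative f (at x) (axis i 1) = deriv \<phi> (x $ i)" if "x \<in> U" for x
    using DERIV_imp_deriv[OF D[OF that]] by simp
  show "smooth_on U (\<lambda>x. deriv \<phi> (x $ i))"
    by (rule smooth_on_cong[OF \<open>open U\<close> eq smooth_on_frechet_derivative[OF sm]])
  assume x: "x \<in> U"
  show 1: "(\<phi> has_field_derivative deriv \<phi> (x $ i)) (at (x $ i))"
    using D[OF x] eq[OF x] by simp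
  have nth: "((\<lambda>y. y $ i) has_derivative (\<lambda>v. v $ i)) (at x)"
    by (rule bounded_linear_imp_has_derivative[OF bounded_linear_vec_nth])
  have "((\<lambda>y. \<phi> (y $ i)) has_derivative (\<lambda>v. deriv \<phi> (x $ i) * v $ i)) (at x)"
    using has_derivative_compose[OF nth, of \<phi> "(*) (deriv \<phi> (x $ i))"] 1
    by (simp add: has_field_derivative_def)
  then show "(f has_derivative (\<lambda>v. deriv \<phi> (x $ i) * v $ i)) (at x)"
    by (rule has_derivative_transform_within_open[OF _ \<open>open U\<close> x]) (use f in simp)
qed

text \<open>With \<open>u = 1 / \<phi>\<close> the equation \<open>d' = d (d + 1)\<close> becomes the linear equation \<open>u'' = u'\<close>.\<close>

lemma log_derivative_ode_solution:
  fixes \<phi> d :: "real \<Rightarrow> real"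
  assumes "convex J" and nz: "\<And>t. t \<in> J \<Longrightarrow> \<phi> t \<noteq> 0"
    and D\<phi>: "\<And>t. t \<in> J \<Longrightarrow> (\<phi> has_field_derivative \<phi> t * d t) (at t)"
    and Dd: "\<And>t. t \<in> J \<Longrightarrow> (d has_field_derivative d t * (d t + 1)) (at t)"
  shows "\<exists>A B. \<forall>t\<in>J. (A + B * exp t) * \<phi> t = 1 \<and> d t = - (B * exp t * \<phi> t)"
proof -
  \<comment> \<open>The quotient \<open>d t / \<phi> t\<close> is \<open>- u'\<close>. It equals its
    own derivative, so its product with \<open>exp (- t)\<close> is a constant \<open>b\<close>, and
    its sum with \<open>u\<close> is a constant \<open>a\<close>. Hence \<open>A = a\<close> and
    \<open>B = - b\<close>.\<close>
  have Dw: "((\<lambda>t. d t / \<phi> t) has_field_derivative d t / \<phi> t) (at t)" if "t \<in> J" for t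
    using DERIV_divide[OF Dd[OF that] D\<phi>[OF that] nz[OF that]] nz[OF that]
    by (simp add: algebra_simps)
  have De: "((\<lambda>t. exp (- t)) has_field_derivative - exp (- t)) (at t)" for t :: real
    by (auto intro!: derivative_eq_intros)
  have Du: "((\<lambda>t. inverse (\<phi> t)) has_field_derivative - (d t / \<phi> t)) (at t)" if "t \<in> J" for t
  proof -
    have "inverse (\<phi> t) * (\<phi> t * d t) * inverse (\<phi> t) = d t / \<phi> t"
      using nz[OF that] by (simp add: field_simps)
    then show ?thesis using DERIV_inverse'[OF D\<phi>[OF that] nz[OF that]] by simp
  qed
  have "((\<lambda>t. d t / \<phi> t * exp (- t)) has_field_derivative 0) (at t within J)" if "t \<in> J" for t
    using has_field_derivative_at_within[OF DERIV_mult[OF Dw[OF that] De]] by simp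
  from has_field_derivative_zero_constant[OF \<open>convex J\<close> this]
  obtain b where b: "\<And>t. t \<in> J \<Longrightarrow> d t / \<phi> t * exp (- t) = b" by auto
  have "((\<lambda>t. inverse (\<phi> t) + d t / \<phi> t) has_field_derivative 0) (at t within J)" if "t \<in> J" for t
    using has_field_derivative_at_within[OF DERIV_add[OF Du[OF that] Dw[OF that]]] by simp
  from has_field_derivative_zero_constant[OF \<open>convex J\<close> this]
  obtain a where a: "\<And>t. t \<in> J \<Longrightarrow> inverse (\<phi> t) + d t / \<phi> t = a" by auto
  have "(a + - b * exp t) * \<phi> t = 1 \<and> d t = - (- b * exp t * \<phi> t)" if t: "t \<in> J" for t
  proof -
    have "d t = b * exp t * \<phi> t"
      using b[OF t] nz[OF t] by (simp add: exp_minus field_simps)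
    moreover have "1 + d t = a * \<phi> t"
      using a[OF t] nz[OF t] by (simp add: field_simps)
    ultimately show ?thesis by (simp add: algebra_simps)
  qed
  then show ?thesis by blast
qed

section \<open>The equivalence on the box and the three cases\<close>

lemma open_box3: "open I1 \<Longrightarrow> open I2 \<Longrightarrow> open I3 \<Longrightarrow> open (box3 I1 I2 I3)"
proof -
  assume "open I1" "open I2" "open I3"
  moreover have "box3 I1 I2 I3 = (\<lambda>x. x $ 1) -` I1 \<inter> (\<lambda>x. x $ 2) -` I2 \<inter> (\<lambda>x. x $ 3) -` I3"
    by (auto simp: box3_def)
  ultimately show ?thesis by (simp add: open_Int open_vimage_vec_nth)
qed

theorem theorem3p32:
  fixes I1 I2 I3 :: "real set" and I :: "(real ^ 3) set"
    and f1 f2 lam mu :: "real ^ 3 \<Rightarrow> real"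
    and \<phi>1 \<phi>2 d h F :: "real \<Rightarrow> real"
  assumes "open_interval I1" "open_interval I2" "open_interval I3"
    and I: "I = box3 I1 I2 I3"
    and "smooth_on I f1" "smooth_on I f2"
    and "\<forall>x\<in>I. f1 x \<noteq> 0" "\<forall>x\<in>I. f2 x \<noteq> 0"
    and "smooth_on I lam" "smooth_on I mu" "\<exists>x\<in>I. mu x \<noteq> 0"
    and "\<forall>x\<in>I. f1 x = \<phi>1 (x $ 2)"
    and "\<forall>x\<in>I. f2 x = \<phi>2 (x $ 3)"
    and d: "d = (\<lambda>t. deriv \<phi>2 t / \<phi>2 t)"
    and h: "h = (\<lambda>s. deriv \<phi>1 s / \<phi>1 s)"
    and F: "F = (\<lambda>s. deriv h s - (h s)\<^sup>2)"
  shows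
    "(almost_eta_ricci_soliton I (g_tilde f1 f2) (E_frame f1 f2) d_dx3 dx3 lam mu \<longleftrightarrow>
        (\<forall>t\<in>I3. deriv d t = d t * (d t + 1)) \<and>
        (\<forall>x\<in>I. deriv \<phi>1 (x $ 2) * deriv \<phi>2 (x $ 3) = 0) \<and>
        (\<forall>x\<in>I. lam x = - (f2 x)\<^sup>2 * F (x $ 2)) \<and>
        (\<forall>x\<in>I. mu x = (f2 x)\<^sup>2 * F (x $ 2) - (deriv d (x $ 3) - (d (x $ 3))\<^sup>2)))
     \<and>
     (almost_eta_ricci_soliton I (g_tilde f1 f2) (E_frame f1 f2) d_dx3 dx3 lam mu \<longrightarrow>
        (\<exists>k2. k2 \<noteq> 0 \<and> (\<forall>x\<in>I. f2 x = k2) \<and>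
           (\<forall>x\<in>I. lam x = - (f2 x)\<^sup>2 * F (x $ 2)) \<and>
           (\<forall>x\<in>I. mu x = (f2 x)\<^sup>2 * F (x $ 2)))
        \<or>
        (\<exists>k1 c1 c2. k1 \<noteq> 0 \<and> (\<forall>x\<in>I. f1 x = k1) \<and> c1 \<noteq> 0 \<and> c2 \<noteq> 0 \<and>
           (\<forall>t\<in>I3. c2 \<noteq> - exp (- t)) \<and>
           (\<forall>x\<in>I. f2 x = c1 / (c2 * exp (x $ 3) + 1)) \<and>
           (\<forall>x\<in>I. lam x = 0) \<and>
           (\<forall>x\<in>I. mu x = c2 * exp (x $ 3) / (c2 * exp (x $ 3) + 1)))
        \<or>
        (\<exists>k1 c0. k1 \<noteq> 0 \<and> (\<forall>x\<in>I. f1 x = k1) \<and> c0 \<noteq> 0 \<and>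
           (\<forall>x\<in>I. f2 x = c0 * exp (- (x $ 3))) \<and>
           (\<forall>x\<in>I. lam x = 0) \<and>
           (\<forall>x\<in>I. mu x = 1)))"
proof -
  let ?soliton = "almost_eta_ricci_soliton I (g_tilde f1 f2) (E_frame f1 f2) d_dx3 dx3 lam mu"
  have open_I: "open I" and conv2: "convex I2" and conv3: "convex I3" and open2: "open I2"
    using assms(1-3) I open_box3 by (auto simp: open_interval_def is_interval_convex)
  have mem: "x \<in> I \<longleftrightarrow> x $ 1 \<in> I1 \<and> x $ 2 \<in> I2 \<and> x $ 3 \<in> I3" for x
    by (simp add: I box3_def)
  obtain p1 p2 p3 where p: "p1 \<in> I1" "p2 \<in> I2" "p3 \<in> I3"
    using assms(1-3) by (auto simp: open_interval_def)
  \<comment> \<open>Every pair of second and third coordinates occurs in the box, which transfers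
    pointwise statements on \<open>I\<close> to \<open>I2\<close> and \<open>I3\<close>.\<close>
  have ex: "\<exists>x\<in>I. x $ 2 = s \<and> x $ 3 = t" if "s \<in> I2" "t \<in> I3" for s t
    by (rule bexI[of _ "vector [p1, s, t]"]) (use that p in \<open>simp_all add: mem vector_3\<close>)
  have f1: "f1 x = \<phi>1 (x $ 2)" "f1 x \<noteq> 0" and f2: "f2 x = \<phi>2 (x $ 3)" "f2 x \<noteq> 0" if "x \<in> I" for x
    using assms that by blast+
  note D1 = smooth_function_of_coordinate[OF open_I \<open>smooth_on I f1\<close> \<open>\<forall>x\<in>I. f1 x = \<phi>1 (x $ 2)\<close>]
  note D2 = smooth_function_of_coordinate[OF open_I \<open>smooth_on I f2\<close> \<open>\<forall>x\<in>I. f2 x = \<phi>2 (x $ 3)\<close>]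
  have h_eq: "h (x $ 2) = deriv \<phi>1 (x $ 2) / f1 x" if "x \<in> I" for x
    using f1[OF that] by (simp add: h)
  have d_eq: "d (x $ 3) = deriv \<phi>2 (x $ 3) / f2 x" if "x \<in> I" for x
    using f2[OF that] by (simp add: d)
  have smooth_h: "smooth_on I (\<lambda>x. h (x $ 2))"
    by (rule smooth_on_cong[OF open_I h_eq[symmetric] smooth_on_divide[OF open_I D1(1) \<open>smooth_on I f1\<close> f1(2)]])
  have smooth_d: "smooth_on I (\<lambda>x. d (x $ 3))"
    by (rule smooth_on_cong[OF open_I d_eq[symmetric] smooth_on_divide[OF open_I D2(1) \<open>smooth_on I f2\<close> f2(2)]])
  note Dh = smooth_function_of_coordinate[where \<phi> = h and i = 2, OF open_I smooth_h ballI[OF refl]]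
  note Dd = smooth_function_of_coordinate[where \<phi> = d and i = 3, OF open_I smooth_d ballI[OF refl]]
  interpret diagonal_metric I f1 f2 "\<lambda>x. h (x $ 2)" "\<lambda>x. d (x $ 3)"
    "\<lambda>x. deriv h (x $ 2)" "\<lambda>x. deriv d (x $ 3)"
  proof
    fix x assume x: "x \<in> I"
    show "(f1 has_derivative (\<lambda>v. f1 x * h (x $ 2) * v $ 2)) (at x)"
      using D1(3)[OF x] h_eq[OF x] f1(2)[OF x] by simp
    show "(f2 has_derivative (\<lambda>v. f2 x * d (x $ 3) * v $ 3)) (at x)"
      using D2(3)[OF x] d_eq[OF x] f2(2)[OF x] by simp
  qed (use open_I assms smooth_h smooth_d f1 f2 Dh(3) Dd(3) in blast)+
  have "?soliton \<longleftrightarrow>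
    (\<forall>x\<in>I. deriv d (x $ 3) = d (x $ 3) * (d (x $ 3) + 1) \<and> d (x $ 3) * h (x $ 2) = 0 \<and>
      lam x = - (f2 x)\<^sup>2 * F (x $ 2) \<and>
      mu x = (f2 x)\<^sup>2 * F (x $ 2) - (deriv d (x $ 3) - (d (x $ 3))\<^sup>2))"
    unfolding F by (rule soliton_iff) (use assms in auto)
  also have "\<dots> \<longleftrightarrow>
        (\<forall>t\<in>I3. deriv d t = d t * (d t + 1)) \<and>
        (\<forall>x\<in>I. deriv \<phi>1 (x $ 2) * deriv \<phi>2 (x $ 3) = 0) \<and>
        (\<forall>x\<in>I. lam x = - (f2 x)\<^sup>2 * F (x $ 2)) \<and>
        (\<forall>x\<in>I. mu x = (f2 x)\<^sup>2 * F (x $ 2) - (deriv d (x $ 3) - (d (x $ 3))\<^sup>2))"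
    (is "_ \<longleftrightarrow> ?eqs")
  proof -
    have "(\<forall>x\<in>I. deriv d (x $ 3) = d (x $ 3) * (d (x $ 3) + 1)) \<longleftrightarrow>
        (\<forall>t\<in>I3. deriv d t = d t * (d t + 1))"
    proof (intro iffI ballI)
      fix t assume t: "t \<in> I3" and *: "\<forall>x\<in>I. deriv d (x $ 3) = d (x $ 3) * (d (x $ 3) + 1)"
      from ex[OF p(2) t] obtain x where "x \<in> I" "x $ 3 = t" by blast
      with * show "deriv d t = d t * (d t + 1)" by blast
    qed (use mem in blast)
    moreover have "d (x $ 3) * h (x $ 2) = 0 \<longleftrightarrow> deriv \<phi>1 (x $ 2) * deriv \<phi>2 (x $ 3) = 0"
      if "x \<in> I" for x
      using that f1(2) f2(2) by (auto simp: h_eq d_eq)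
    ultimately show ?thesis by auto
  qed
  finally have iff: "?soliton \<longleftrightarrow> ?eqs" .
  show ?thesis
  proof (rule conjI[OF iff], rule impI)
    assume "?soliton"
    with iff have ode: "\<And>t. t \<in> I3 \<Longrightarrow> deriv d t = d t * (d t + 1)"
      and prod0: "\<And>x. x \<in> I \<Longrightarrow> deriv \<phi>1 (x $ 2) * deriv \<phi>2 (x $ 3) = 0"
      and lam: "\<And>x. x \<in> I \<Longrightarrow> lam x = - (f2 x)\<^sup>2 * F (x $ 2)"
      and mu: "\<And>x. x \<in> I \<Longrightarrow> mu x = (f2 x)\<^sup>2 * F (x $ 2) - (deriv d (x $ 3) - (d (x $ 3))\<^sup>2)"
      by blast+
    have \<phi>1: "\<phi>1 s \<noteq> 0" "(\<phi>1 has_field_derivative deriv \<phi>1 s) (at s)"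
      "(h has_field_derivative deriv h s) (at s)" if "s \<in> I2" for s
    proof -
      from ex[OF that p(3)] obtain x where x: "x \<in> I" "x $ 2 = s" by blast
      show "\<phi>1 s \<noteq> 0" "(\<phi>1 has_field_derivative deriv \<phi>1 s) (at s)"
        "(h has_field_derivative deriv h s) (at s)"
        using f1[OF x(1)] D1(2)[OF x(1)] Dh(2)[OF x(1)] by (simp_all add: x(2))
    qed
    have \<phi>2: "\<phi>2 t \<noteq> 0" "(\<phi>2 has_field_derivative deriv \<phi>2 t) (at t)"
      "(d has_field_derivative deriv d t) (at t)" if "t \<in> I3" for t
    proof -
      from ex[OF p(2) that] obtain x where x: "x \<in> I" "x $ 3 = t" by blast
      show "\<phi>2 t \<noteq> 0" "(\<phi>2 has_field_derivative deriv \<phi>2 t) (at t)"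
        "(d has_field_derivative deriv d t) (at t)"
        using f2[OF x(1)] D2(2)[OF x(1)] Dd(2)[OF x(1)] by (simp_all add: x(2))
    qed
    show "(\<exists>k2. k2 \<noteq> 0 \<and> (\<forall>x\<in>I. f2 x = k2) \<and>
           (\<forall>x\<in>I. lam x = - (f2 x)\<^sup>2 * F (x $ 2)) \<and>
           (\<forall>x\<in>I. mu x = (f2 x)\<^sup>2 * F (x $ 2)))
        \<or>
        (\<exists>k1 c1 c2. k1 \<noteq> 0 \<and> (\<forall>x\<in>I. f1 x = k1) \<and> c1 \<noteq> 0 \<and> c2 \<noteq> 0 \<and>
           (\<forall>t\<in>I3. c2 \<noteq> - exp (- t)) \<and>
           (\<forall>x\<in>I. f2 x = c1 / (c2 * exp (x $ 3) + 1)) \<and>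
           (\<forall>x\<in>I. lam x = 0) \<and>
           (\<forall>x\<in>I. mu x = c2 * exp (x $ 3) / (c2 * exp (x $ 3) + 1)))
        \<or>
        (\<exists>k1 c0. k1 \<noteq> 0 \<and> (\<forall>x\<in>I. f1 x = k1) \<and> c0 \<noteq> 0 \<and>
           (\<forall>x\<in>I. f2 x = c0 * exp (- (x $ 3))) \<and>
           (\<forall>x\<in>I. lam x = 0) \<and>
           (\<forall>x\<in>I. mu x = 1))" (is "?case1 \<or> ?case2 \<or> ?case3")
    \<comment> \<open>The split is whether \<open>f2\<close> is constant; if it is, \<open>d\<close>
      vanishes and the equation for \<open>d\<close> removes the last bracket from
      \<open>mu\<close>.\<close>
    proof (cases "\<forall>t\<in>I3. deriv \<phi>2 t = 0")
      case True
      have "\<exists>k. \<forall>t\<in>I3. \<phi>2 t = k"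
        by (rule has_field_derivative_zero_constant[OF conv3 has_field_derivative_at_within])
          (use True \<phi>2(2) in force)
      then obtain k where k: "\<And>t. t \<in> I3 \<Longrightarrow> \<phi>2 t = k" by blast
      have "k \<noteq> 0" using k \<phi>2(1) p(3) by blast
      moreover have "f2 x = k" if "x \<in> I" for x using f2(1)[OF that] k mem that by simp
      moreover have "mu x = (f2 x)\<^sup>2 * F (x $ 2)" if "x \<in> I" for x
      proof -
        have "d (x $ 3) = 0" using True that mem by (simp add: d)
        then show ?thesis using mu[OF that] ode[of "x $ 3"] that mem by simp
      qed
      ultimately show ?thesis using lam by blast
    next
      case False
      then obtain t0 where t0: "t0 \<in> I3" "deriv \<phi>2 t0 \<noteq> 0" by blast
      \<comment> \<open>For each \<open>s\<close> the box has a point with coordinates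
        \<open>s\<close> and \<open>t0\<close>. There the product condition forces the derivative of
        \<open>\<phi>1\<close> to vanish.\<close>
      have zero: "deriv \<phi>1 s = 0" if "s \<in> I2" for s
        using ex[OF that t0(1)] prod0 t0(2) by force
      have "\<exists>k. \<forall>s\<in>I2. \<phi>1 s = k"
        by (rule has_field_derivative_zero_constant[OF conv2 has_field_derivative_at_within])
          (use zero \<phi>1(2) in force)
      then obtain k1 where k1: "\<And>s. s \<in> I2 \<Longrightarrow> \<phi>1 s = k1" by blast
      have f1_const: "k1 \<noteq> 0" "\<forall>x\<in>I. f1 x = k1"
        using k1 \<phi>1(1) p(2) f1(1) mem by auto
      have F0: "F s = 0" if s: "s \<in> I2" for s
      proof -
        \<comment> \<open>\<open>h\<close> is known to vanish only on \<open>I2\<close>, but this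
          set is open, so the derivative of \<open>h\<close> vanishes there as well.\<close>
        have h0: "0 = h s" if "s \<in> I2" for s using zero[OF that] by (simp add: h)
        have "(h has_field_derivative 0) (at s)"
          by (rule has_field_derivative_transform_within_open[OF DERIV_const open2 s h0])
        then have "deriv h s = 0" by (rule DERIV_imp_deriv)
        then show ?thesis using h0[OF s] by (simp add: F)
      qed
      have lam0: "\<forall>x\<in>I. lam x = 0" using lam F0 mem by simp
      \<comment> \<open>With \<open>F\<close> zero, the equation for \<open>d\<close> turns
        \<open>deriv d - d\<^sup>2\<close> into \<open>d\<close>.\<close>
      have mu_d: "mu x = - d (x $ 3)" if "x \<in> I" for x
        using mu[OF that] F0 ode[of "x $ 3"] that mem by (simp add: power2_eq_square algebra_simps)
      have "\<exists>A B. \<forall>t\<in>I3. (A + B * exp t) * \<phi>2 t = 1 \<and> d t = - (B * exp t * \<phi>2 t)"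
      proof (rule log_derivative_ode_solution[OF conv3])
        fix t assume t: "t \<in> I3"
        show "\<phi>2 t \<noteq> 0" by (rule \<phi>2(1)[OF t])
        show "(\<phi>2 has_field_derivative \<phi>2 t * d t) (at t)"
          using \<phi>2(1,2)[OF t] by (simp add: d)
        show "(d has_field_derivative d t * (d t + 1)) (at t)"
          using \<phi>2(3)[OF t] ode[OF t] by simp
      qed
      then obtain A B where AB: "\<And>t. t \<in> I3 \<Longrightarrow> (A + B * exp t) * \<phi>2 t = 1"
        and dB: "\<And>t. t \<in> I3 \<Longrightarrow> d t = - (B * exp t * \<phi>2 t)" by blast
      \<comment> \<open>If \<open>B\<close> were zero, \<open>d\<close> would vanish at
        \<open>t0\<close>, against the choice of \<open>t0\<close>.\<close>
      have "B \<noteq> 0" using dB[OF t0(1)] t0(2) \<phi>2(1)[OF t0(1)] by (auto simp: d)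
      show ?thesis
      proof (cases "A = 0")
        case True
        \<comment> \<open>Here \<open>B * exp t * \<phi>2 t = 1\<close>, hence
          \<open>d = - 1\<close> and \<open>mu = 1\<close>; the constant \<open>c0\<close> is
          \<open>1 / B\<close>.\<close>
        have "f2 x = 1 / B * exp (- (x $ 3)) \<and> mu x = 1" if "x \<in> I" for x
          using AB[of "x $ 3"] dB[of "x $ 3"] mu_d[OF that] f2(1)[OF that] True \<open>B \<noteq> 0\<close> that mem
          by (simp add: exp_minus field_simps)
        then have ?case3
          using f1_const lam0 \<open>B \<noteq> 0\<close> by (intro exI[of _ k1] exI[of _ "1 / B"]) simp
        then show ?thesis by blast
      next
        case False
        \<comment> \<open>Dividing by \<open>A\<close> gives \<open>c1 = 1 / A\<close> and
          \<open>c2 = B / A\<close>. The denominator cannot vanish because its product with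
          \<open>A * \<phi>2 t\<close> is 1.\<close>
        have nz: "B / A * exp t + 1 \<noteq> 0" if "t \<in> I3" for t
        proof -
          have "A * (B / A * exp t + 1) * \<phi>2 t = 1"
            using AB[OF that] False by (simp add: algebra_simps)
          then show ?thesis by auto
        qed
        have "B / A \<noteq> - exp (- t)" if "t \<in> I3" for t
        proof
          assume "B / A = - exp (- t)"
          with nz[OF that] show False by (simp flip: exp_add)
        qed
        moreover have "f2 x = 1 / A / (B / A * exp (x $ 3) + 1)
            \<and> mu x = B / A * exp (x $ 3) / (B / A * exp (x $ 3) + 1)" if "x \<in> I" for x
        proof -
          have x3: "x $ 3 \<in> I3" using that mem by blast
          have "A * (B / A * exp (x $ 3) + 1) * f2 x = 1"
            using AB[OF x3] f2(1)[OF that] False by (simp add: algebra_simps)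
          then have "f2 x = 1 / A / (B / A * exp (x $ 3) + 1)"
            using nz[OF x3] False by (simp add: nonzero_eq_divide_eq mult_ac)
          moreover have "mu x = B * exp (x $ 3) * f2 x"
            using mu_d[OF that] dB[OF x3] f2(1)[OF that] by simp
          ultimately show ?thesis by simp
        qed
        ultimately have ?case2
          using f1_const lam0 \<open>B \<noteq> 0\<close> False
          by (intro exI[of _ k1] exI[of _ "1 / A"] exI[of _ "B / A"]) simp
        then show ?thesis by blast
      qed
    qed
  qed
qed

end
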